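(* Let $G$ be a directed graph on vertex set $[n]$ (no loops, multiple edges allowed) and write $$\omega\, \mathrm G_G(\mathbf x;q+1)=\sum_{\alpha\vDash n}c^G_\alpha(q)\frac{\Psi_\alpha(\mathbf x)}{z_\alpha}.$$ Then $c^G_\alpha(q)\in\mathbb N[q]$ for all compositions $\alpha$.
   Context: For a coloring $\kappa:[n]\to\mathbb Z_{>0}$, $\mathrm{asc}(\kappa)$ is the number of directed edges $(i,j)$ (with multiplicity) with $\kappa(i)<\kappa(j)$. The unicellular graph LLT polynomial is $\mathrm G_G(\mathbf x;q)=\sum_{\kappa:[n]\to\mathbb Z_{>0}}x_{\kappa(1)}\cdots x_{\kappa(n)}q^{\mathrm{asc}(\kappa)}$ (sum over all colorings); $\mathrm G_G(\mathbf x;q+1)$ is obtained by substituting $q+1$ for $q$. $\omega$ is the linear automorphism of quasisymmetric functions with $\omega(F_{n,S})=F_{n,[n-1]\setminus(n-S)}$, where $F_{n,S}=\sum_{j_1\le\dots\le j_n,\ j_i<j_{i+1}\ (i\in S)}x_{j_1}\cdots x_{j_n}$ and $n-S=\{n-s:s\in S\}$, extended coefficientwise in $q$. For compositions: $S_\alpha=\{\alpha_1,\dots,\alpha_1+\dots+\alpha_{\ell-1}\}$, blocks $B_i(\alpha)$ consecutive intervals of sizes $\alpha_i$, $\alpha\le\beta$ iff $S_\beta\subseteq S_\alpha$; $M_\alpha=\sum_{i_1<\dots<i_\ell}x_{i_1}^{\alpha_1}\cdots x_{i_\ell}^{\alpha_\ell}$; $z_\alpha=\prod_i i^{m_i}m_i!$;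 $\pi(\gamma)=\prod_i(\gamma_1+\dots+\gamma_i)$; $\pi(\alpha,\beta)=\prod_i\pi(\alpha^{(i)})$ with $\alpha^{(i)}$ the parts of $\alpha$ whose blocks lie in $B_i(\beta)$; $\Psi_\alpha=z_\alpha\sum_{\beta\ge\alpha}\pi(\alpha,\beta)^{-1}M_\beta$. *)

theory Defs
  imports "HOL-Computational_Algebra.Polynomial" "HOL-Library.FuncSet"
begin

(* A formal power series in the variables x_1, x_2, ... (indexed by positive naturals)
   with coefficients in a ring 'b is represented by its coefficient function on
   monomials; a monomial is an exponent vector m :: nat => nat (m c = exponent of x_c). *)
type_synonym 'b fps_x = "(nat \<Rightarrow> nat) \<Rightarrow> 'b"

(* Directed graph on [n] = {1..n}: E i j = multiplicity of the directed edge (i,j). *)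
definition is_digraph :: "nat \<Rightarrow> (nat \<Rightarrow> nat \<Rightarrow> nat) \<Rightarrow> bool" where
  "is_digraph n E \<longleftrightarrow> (\<forall>i. E i i = 0) \<and>
     (\<forall>i j. E i j \<noteq> 0 \<longrightarrow> i \<in> {1..n} \<and> j \<in> {1..n})"

definition asc :: "nat \<Rightarrow> (nat \<Rightarrow> nat \<Rightarrow> nat) \<Rightarrow> (nat \<Rightarrow> nat) \<Rightarrow> nat" where
  "asc n E \<kappa> = (\<Sum>i\<in>{1..n}. \<Sum>j\<in>{1..n}. if \<kappa> i < \<kappa> j then E i j else 0)"

definition colorings_with_content :: "nat \<Rightarrow> (nat \<Rightarrow> nat) \<Rightarrow> (nat \<Rightarrow> nat) set" where
  "colorings_with_content n m =
     {\<kappa> \<in> {1..n} \<rightarrow>\<^sub>E {1..}. \<forall>c. card {i \<in> {1..n}. \<kappa> i = c} = m c}"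

definition LLT :: "nat \<Rightarrow> (nat \<Rightarrow> nat \<Rightarrow> nat) \<Rightarrow> rat poly fps_x" where
  "LLT n E = (\<lambda>m. \<Sum>\<kappa>\<in>colorings_with_content n m. monom 1 (asc n E \<kappa>))"

definition LLT_shift :: "nat \<Rightarrow> (nat \<Rightarrow> nat \<Rightarrow> nat) \<Rightarrow> rat poly fps_x" where
  "LLT_shift n E = (\<lambda>m. pcompose (LLT n E m) [:1, 1:])"

(* fundamental quasisymmetric function F_{n,S}; sequences j_1 <= ... <= j_n (list indices 0..n-1) *)
definition F_qsym :: "nat \<Rightarrow> nat set \<Rightarrow> rat fps_x" where
  "F_qsym n S = (\<lambda>m. of_nat (card {js :: nat list. length js = n \<and> sorted js \<and>
       (\<forall>x\<in>set js. 1 \<le> x) \<and> (\<forall>i\<in>S. js ! (i - 1) < js ! i) \<and>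
       (\<forall>c. count_list js c = m c)}))"

definition omega_set :: "nat \<Rightarrow> nat set \<Rightarrow> nat set" where
  "omega_set n S = {1..<n} - (\<lambda>s. n - s) ` S"

(* omega f = g, where omega is the linear map with omega(F_{n,S}) = F_{n,[n-1]\(n-S)},
   extended coefficientwise in q; f, g homogeneous of degree n *)
definition omega_rel :: "nat \<Rightarrow> rat poly fps_x \<Rightarrow> rat poly fps_x \<Rightarrow> bool" where
  "omega_rel n f g \<longleftrightarrow> (\<exists>d :: nat set \<Rightarrow> rat poly.
      (\<forall>m. f m = (\<Sum>S\<in>Pow {1..<n}. d S * [:F_qsym n S m:])) \<and>
      (\<forall>m. g m = (\<Sum>S\<in>Pow {1..<n}. d S * [:F_qsym n (omega_set n S) m:])))"

definition compositions :: "nat \<Rightarrow> nat list set" where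
  "compositions n = {\<alpha>. (\<forall>a\<in>set \<alpha>. 0 < a) \<and> sum_list \<alpha> = n}"

definition S_comp :: "nat list \<Rightarrow> nat set" where
  "S_comp \<alpha> = {sum_list (take i \<alpha>) | i. 1 \<le> i \<and> i < length \<alpha>}"

definition comp_le :: "nat list \<Rightarrow> nat list \<Rightarrow> bool" where
  "comp_le \<alpha> \<beta> \<longleftrightarrow> S_comp \<beta> \<subseteq> S_comp \<alpha>"

definition M_qsym :: "nat list \<Rightarrow> rat fps_x" where
  "M_qsym \<alpha> = (\<lambda>m. of_nat (card {idx :: nat list. length idx = length \<alpha> \<and>
       sorted_wrt (<) idx \<and> (\<forall>i\<in>set idx. 1 \<le> i) \<and>
       (\<forall>c. m c = sum_list [\<alpha> ! k. k \<leftarrow> [0..<length \<alpha>], idx ! k = c])}))"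

definition z_comp :: "nat list \<Rightarrow> nat" where
  "z_comp \<alpha> = (\<Prod>i\<in>set \<alpha>. i ^ count_list \<alpha> i * fact (count_list \<alpha> i))"

definition pi_comp :: "nat list \<Rightarrow> nat" where
  "pi_comp \<gamma> = prod_list (map (\<lambda>i. sum_list (take i \<gamma>)) [1..<Suc (length \<gamma>)])"

(* for beta >= alpha: the lists alpha^{(1)}, alpha^{(2)}, ... of parts of alpha whose
   blocks lie in the successive blocks B_i(beta) *)
fun comp_blocks :: "nat list \<Rightarrow> nat list \<Rightarrow> nat list list" where
  "comp_blocks \<alpha> [] = []"
| "comp_blocks \<alpha> (b # bs) =
     (let k = length (filter (\<lambda>j. sum_list (take j \<alpha>) \<le> b) [1..<Suc (length \<alpha>)])
      in take k \<alpha> # comp_blocks (drop k \<alpha>) bs)"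

definition pi2_comp :: "nat list \<Rightarrow> nat list \<Rightarrow> nat" where
  "pi2_comp \<alpha> \<beta> = prod_list (map pi_comp (comp_blocks \<alpha> \<beta>))"

definition Psi_qsym :: "nat list \<Rightarrow> rat fps_x" where
  "Psi_qsym \<alpha> = (\<lambda>m. of_nat (z_comp \<alpha>) *
     (\<Sum>\<beta>\<in>{\<beta> \<in> compositions (sum_list \<alpha>). comp_le \<alpha> \<beta>}.
        M_qsym \<beta> m / of_nat (pi2_comp \<alpha> \<beta>)))"

definition is_Psi_expansion :: "nat \<Rightarrow> (nat \<Rightarrow> nat \<Rightarrow> nat) \<Rightarrow> (nat list \<Rightarrow> rat poly) \<Rightarrow> bool" where
  "is_Psi_expansion n E c \<longleftrightarrow>
     omega_rel n (LLT_shift n E)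
       (\<lambda>m. \<Sum>\<alpha>\<in>compositions n. c \<alpha> * [:Psi_qsym \<alpha> m / of_nat (z_comp \<alpha>):])"

end

theory Submission
  imports Defs "HOL-Library.Product_Lexorder"
begin

text \<open>
  Substituting \<open>q + 1\<close> for \<open>q\<close> turns \<open>q\<close> to the power \<open>asc \<kappa>\<close> into a sum over the sets \<open>A\<close> of
  ascending edges of \<open>\<kappa>\<close>, each with a weight in \<open>\<nat>[q]\<close>. So the shifted LLT polynomial is a sum of
  generating functions of colorings that increase strictly along the edges in \<open>A\<close>; only acyclic \<open>A\<close>
  contribute. By Stanley's expansion into fundamental quasisymmetric functions over linear
  extensions, \<open>\<omega>\<close> sends such a generating function to that of the weakly monotone colorings
  of the opposite poset. The latter expands positively into the \<open>\<Psi>\<^sub>\<alpha> / z\<^sub>\<alpha>\<close>: the coefficient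
  counts the chains of order ideals whose successive differences have sizes \<open>\<alpha>\<close> and a least
  element each. Uniqueness of the coefficients holds because the \<open>\<Psi>\<^sub>\<alpha>\<close> are triangular with respect
  to the monomial basis.
\<close>

section \<open>Chains of order ideals\<close>

text \<open>The denominators in \<open>Psi_qsym\<close> are probabilities. In a finite poset pick an
  element uniformly at random, remove the principal filter it generates, and repeat on the remaining
  order ideal until nothing is left. Read backwards, the removed filters are the blocks of a chain
  whose blocks have least elements. A chain of type \<alpha> arises with probability 1 /
  \<pi>(\<alpha>): the ideals from which elements are drawn have the partial sums of \<alpha> as
  sizes, and exactly one element of each gives the required filter. Total probability 1 is
  \<open>sum_chain_count_pi\<close>. A weakly monotone coloring is a chain of ideals with arbitrary
  blocks, of sizes \<beta>. Running the process inside every block refines it to chains of types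
  \<alpha> with weight 1 / \<pi>(\<alpha>, \<beta>), which is the coefficient of M_\<beta> in
  \<Psi>_\<alpha> / z_\<alpha>. A further obstacle is that \<open>omega_rel\<close> only asserts the
  existence of suitable coefficients. So the strict and the weak functions have to be expanded with
  one common family, and comparing two images under \<omega> needs the linear independence of the
  fundamental functions.\<close>

definition downset :: "('a \<times> 'a) set \<Rightarrow> 'a set \<Rightarrow> 'a set \<Rightarrow> bool" where
  "downset P V U \<longleftrightarrow> U \<subseteq> V \<and> (\<forall>y\<in>U. \<forall>x\<in>V. (x, y) \<in> P \<longrightarrow> x \<in> U)"

definition has_least :: "('a \<times> 'a) set \<Rightarrow> 'a set \<Rightarrow> bool" where
  "has_least P U \<longleftrightarrow> (\<exists>x\<in>U. \<forall>y\<in>U. (x, y) \<in> P)"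

text \<open>A chain is recorded by its successive differences. \<open>P\<close> stays fixed while
  the ground set shrinks, so parts of the poset carry the induced order without restricting
  \<open>P\<close>. The block condition \<open>Q\<close> is \<open>has_least P\<close> for the
  \<Psi> coefficients and constantly true for the monomial ones.\<close>

fun chain_count :: "('a \<times> 'a) set \<Rightarrow> ('a set \<Rightarrow> bool) \<Rightarrow> 'a set \<Rightarrow> nat list \<Rightarrow> nat" where
  "chain_count P Q V [] = (if V = {} then 1 else 0)"
| "chain_count P Q V (a # as) =
     (\<Sum>U | downset P V U \<and> card U = a \<and> Q U. chain_count P Q (V - U) as)"

lemma downset_subset: "downset P V U \<Longrightarrow> U \<subseteq> V"
  by (simp add: downset_def)

lemma finite_downsets: "finite V \<Longrightarrow> finite {U. downset P V U \<and> R U}"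
  by (rule finite_subset[of _ "Pow V"]) (auto dest: downset_subset)

text \<open>Both sides say that \<open>U\<close> and \<open>W\<close> are ideals of
  \<open>V\<close>. This allows choosing the larger ideal first and the smaller one inside
  it.\<close>

lemma downset_trans_iff:
  assumes "U \<subseteq> W"
  shows "downset P V U \<and> downset P (V - U) (W - U) \<longleftrightarrow> downset P V W \<and> downset P W U"
  using assms unfolding downset_def by blast

text \<open>The union \<open>W\<close> of the blocks belonging to \<open>as\<close> cuts the chain
  into a chain of the ideal \<open>W\<close> and a chain of its complement.\<close>

lemma chain_count_append:
  assumes "finite V"
  shows "chain_count P Q V (as @ bs) =
    (\<Sum>W | downset P V W \<and> card W = sum_list as. chain_count P Q W as * chain_count P Q (V - W) bs)"
  using assms
proof (induction as arbitrary: V)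
  case Nil
  have "{W. downset P V W \<and> card W = 0} = {{}}"
    using Nil by (auto simp: downset_def dest: finite_subset)
  then show ?case by simp
next
  case (Cons a as)
  let ?X = "\<lambda>V. {U. downset P V U \<and> card U = a \<and> Q U}"
  let ?Y = "\<lambda>V s. {W. downset P V W \<and> card W = s}"
  have fin: "finite (V - U)" for U using Cons.prems by simp
  have fW: "finite W" if "downset P V W" for W
    using that Cons.prems by (meson downset_subset finite_subset)
  have "chain_count P Q V ((a # as) @ bs) =
    (\<Sum>U\<in>?X V. \<Sum>W\<in>?Y (V - U) (sum_list as). chain_count P Q W as * chain_count P Q (V - U - W) bs)"
    using Cons.IH[OF fin] by simp
  also have "\<dots> = (\<Sum>(U, W)\<in>(SIGMA U:?X V. ?Y (V - U) (sum_list as)).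
      chain_count P Q W as * chain_count P Q (V - U - W) bs)"
    by (rule sum.Sigma) (auto intro!: finite_downsets Cons.prems)
  \<comment> \<open>The index \<open>W\<close> changes its meaning here: before, it is the part of
    the ideal left after the first block \<open>U\<close>; afterwards, it is the whole
    ideal.\<close>
  also have "\<dots> = (\<Sum>(W, U)\<in>(SIGMA W:?Y V (a + sum_list as). ?X W).
      chain_count P Q (W - U) as * chain_count P Q (V - W) bs)"
  proof (rule sum.reindex_bij_witness[where i = "\<lambda>(W, U). (U, W - U)" and j = "\<lambda>(U, W). (U \<union> W, U)"], goal_cases)
    case (1 x)
    then show ?case by (auto simp: downset_def)
  next
    case (2 x)
    then obtain U W where x: "x = (U, W)" "downset P V U" "card U = a" "Q U"
      "downset P (V - U) W" "card W = sum_list as" by auto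
    have "W - U = W" "(U \<union> W) - U = W" using x(5) by (auto simp: downset_def)
    moreover have "card (U \<union> W) = card U + card W"
      using x fW[OF x(2)] finite_subset[OF downset_subset[OF x(5)] fin]
      by (intro card_Un_disjoint) (auto simp: downset_def)
    ultimately show ?case using downset_trans_iff[of U "U \<union> W" P V] x by auto
  next
    case (3 y)
    then show ?case by (auto dest: downset_subset)
  next
    case (4 y)
    then obtain W U where y: "y = (W, U)" "downset P V W" "card W = a + sum_list as" "downset P W U"
      "card U = a" "Q U" by auto
    have "card (W - U) = card W - card U"
      using y fW[OF y(2)] by (meson card_Diff_subset downset_subset finite_subset)
    then show ?case using y downset_trans_iff[of U W P V] downset_subset[OF y(4)] by auto
  next
    case (5 x)
    then obtain U W where x: "x = (U, W)"
      "downset P (V - U) W" by auto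
    have "W - U = W" "U \<union> W - U = W" "V - U - W = V - (U \<union> W)" using x(2) by (auto simp: downset_def)
    then show ?case using x by simp
  qed
  also have "\<dots> = (\<Sum>W\<in>?Y V (a + sum_list as). \<Sum>U\<in>?X W.
      chain_count P Q (W - U) as * chain_count P Q (V - W) bs)"
    by (rule sum.Sigma[symmetric]) (auto intro!: finite_downsets Cons.prems fW)
  finally show ?case by (simp add: sum_distrib_right)
qed

lemma chain_count_single:
  assumes "finite V"
  shows "chain_count P Q V [a] = (if card V = a \<and> Q V then 1 else 0)"
proof -
  have "chain_count P Q V [a] = (\<Sum>U | downset P V U \<and> card U = a \<and> Q U. if U = V then 1 else 0)"
    by (auto intro!: sum.cong dest: downset_subset)
  also have "\<dots> = (if card V = a \<and> Q V then 1 else 0)"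
    using assms by (subst sum.delta) (auto intro!: finite_downsets simp: downset_def)
  finally show ?thesis .
qed

lemma compositions_0: "compositions 0 = {[]}"
  by (auto simp: compositions_def) (metis list.set_intros(1) neq_Nil_conv not_less_zero)

text \<open>The last part is split off because the factors of \<open>pi_comp\<close> are initial
  partial sums: removing the last part removes just one factor.\<close>

lemma compositions_snoc:
  assumes "n > 0"
  shows "bij_betw (\<lambda>(k, \<alpha>). \<alpha> @ [n - k]) (SIGMA k:{..<n}. compositions k) (compositions n)"
proof (rule bij_betwI')
  fix x y assume "x \<in> (SIGMA k:{..<n}. compositions k)" "y \<in> (SIGMA k:{..<n}. compositions k)"
  then show "((case x of (k, \<alpha>) \<Rightarrow> \<alpha> @ [n - k]) = (case y of (k, \<alpha>) \<Rightarrow> \<alpha> @ [n - k])) = (x = y)"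
    by (auto simp: compositions_def)
next
  fix x assume "x \<in> (SIGMA k:{..<n}. compositions k)"
  then show "(case x of (k, \<alpha>) \<Rightarrow> \<alpha> @ [n - k]) \<in> compositions n"
    by (auto simp: compositions_def)
next
  fix y assume y: "y \<in> compositions n"
  with assms have ne: "y \<noteq> []" by (auto simp: compositions_def)
  then obtain \<alpha> a where ya: "y = \<alpha> @ [a]" by (metis rev_exhaust)
  with y have "a = n - sum_list \<alpha>" "sum_list \<alpha> < n" "\<alpha> \<in> compositions (sum_list \<alpha>)"
    by (auto simp: compositions_def)
  then show "\<exists>x\<in>(SIGMA k:{..<n}. compositions k). y = (case x of (k, \<alpha>) \<Rightarrow> \<alpha> @ [n - k])"
    using ya by (intro bexI[of _ "(sum_list \<alpha>, \<alpha>)"]) auto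
qed

lemma finite_compositions: "finite (compositions n)"
proof (induction n rule: less_induct)
  case (less n)
  show ?case
  proof (cases "n = 0")
    case True
    then show ?thesis by (simp add: compositions_0)
  next
    case False
    then show ?thesis
      using bij_betw_finite[OF compositions_snoc[of n]] less by auto
  qed
qed

lemma pi_comp_snoc: "pi_comp (\<alpha> @ [a]) = pi_comp \<alpha> * (sum_list \<alpha> + a)"
proof -
  have "map (\<lambda>i. sum_list (take i (\<alpha> @ [a]))) [1..<Suc (length \<alpha>)]
    = map (\<lambda>i. sum_list (take i \<alpha>)) [1..<Suc (length \<alpha>)]"
    by (rule map_cong) auto
  moreover have "[1..<Suc (length (\<alpha> @ [a]))] = [1..<Suc (length \<alpha>)] @ [Suc (length \<alpha>)]"
    by simp
  ultimately have "map (\<lambda>i. sum_list (take i (\<alpha> @ [a]))) [1..<Suc (length (\<alpha> @ [a]))] =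
      map (\<lambda>i. sum_list (take i \<alpha>)) [1..<Suc (length \<alpha>)] @ [sum_list \<alpha> + a]"
    by (simp only: map_append) simp
  then show ?thesis unfolding pi_comp_def by (simp only: prod_list.append) simp
qed

text \<open>If the complement of an ideal has a least element \<open>x\<close>, it is the principal
  filter at \<open>x\<close>, and antisymmetry makes \<open>x\<close> unique. So there are exactly
  \<open>card V\<close> such ideals.\<close>

lemma coatomic_filters:
  assumes "refl P" "trans P" "antisym P"
  shows "bij_betw (\<lambda>x. {y \<in> V. (x, y) \<notin> P}) V {W. downset P V W \<and> W \<noteq> V \<and> has_least P (V - W)}"
proof (rule bij_betwI')
  fix x x' assume "x \<in> V" "x' \<in> V"
  then show "({y \<in> V. (x, y) \<notin> P} = {y \<in> V. (x', y) \<notin> P}) = (x = x')"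
    using assms by (auto simp: refl_on_def dest: antisymD)
next
  fix x assume "x \<in> V"
  then show "{y \<in> V. (x, y) \<notin> P} \<in> {W. downset P V W \<and> W \<noteq> V \<and> has_least P (V - W)}"
    using assms by (auto simp: refl_on_def downset_def has_least_def dest: transD)
next
  fix W assume "W \<in> {W. downset P V W \<and> W \<noteq> V \<and> has_least P (V - W)}"
  then obtain x where x: "x \<in> V" "x \<notin> W" "\<forall>y\<in>V - W. (x, y) \<in> P" and W: "downset P V W"
    by (auto simp: has_least_def)
  then have "W = {y \<in> V. (x, y) \<notin> P}" by (auto simp: downset_def)
  then show "\<exists>x\<in>V. W = {y \<in> V. (x, y) \<notin> P}" using x by blast
qed

text \<open>The last block of a chain counted here is a principal filter, so it is determined by an
  arbitrary element of \<open>V\<close>, and the last factor of \<open>\<pi>(\<alpha>)\<close> is the number of elements of \<open>V\<close>.\<close>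

lemma sum_chain_count_pi:
  assumes "finite V" "refl P" "trans P" "antisym P"
  shows "(\<Sum>\<alpha>\<in>compositions (card V). of_nat (chain_count P (has_least P) V \<alpha>) / of_nat (pi_comp \<alpha>)) = (1::rat)"
  using assms(1)
proof (induction "card V" arbitrary: V rule: less_induct)
  case less
  note fin = finite_downsets[OF less.prems]
  let ?c = "\<lambda>V \<alpha>. of_nat (chain_count P (has_least P) V \<alpha>) :: rat"
  let ?n = "card V"
  show ?case
  proof (cases "V = {}")
    case True
    then show ?thesis by (simp add: compositions_0 pi_comp_def)
  next
    case False
    then have n: "?n > 0" using less.prems by (simp add: card_gt_0_iff)
    have snoc: "?c V (\<alpha> @ [?n - k]) / of_nat (pi_comp (\<alpha> @ [?n - k])) =
        (\<Sum>W | downset P V W \<and> card W = k \<and> has_least P (V - W). ?c W \<alpha> / of_nat (pi_comp \<alpha>) / of_nat ?n)"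
      if "k < ?n" "\<alpha> \<in> compositions k" for k \<alpha>
    proof -
      have s: "sum_list \<alpha> = k" using that by (simp add: compositions_def)
      have "?c V (\<alpha> @ [?n - k]) = (\<Sum>W | downset P V W \<and> card W = k.
          ?c W \<alpha> * (if has_least P (V - W) then 1 else 0))"
        unfolding chain_count_append[OF less.prems] s of_nat_sum
      proof (rule sum.cong[OF refl])
        fix W assume "W \<in> {W. downset P V W \<and> card W = k}"
        then have "card (V - W) = ?n - k"
          by (metis (mono_tags, lifting) card_Diff_subset downset_subset less.prems mem_Collect_eq rev_finite_subset)
        then show "of_nat (chain_count P (has_least P) W \<alpha> * chain_count P (has_least P) (V - W) [?n - k]) =
           ?c W \<alpha> * (if has_least P (V - W) then 1 else 0)"
          using less.prems by (simp add: chain_count_single del: chain_count.simps)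
      qed
      also have "\<dots> = (\<Sum>W | downset P V W \<and> card W = k \<and> has_least P (V - W). ?c W \<alpha>)"
        by (rule sum.mono_neutral_cong_right) (auto intro: fin)
      finally show ?thesis using that s
        by (simp add: pi_comp_snoc sum_divide_distrib)
    qed
    have "(\<Sum>\<alpha>\<in>compositions ?n. ?c V \<alpha> / of_nat (pi_comp \<alpha>)) =
      (\<Sum>(k, \<alpha>)\<in>(SIGMA k:{..<?n}. compositions k). ?c V (\<alpha> @ [?n - k]) / of_nat (pi_comp (\<alpha> @ [?n - k])))"
      using sum.reindex_bij_betw[OF compositions_snoc[OF n],
          of "\<lambda>\<alpha>. ?c V \<alpha> / of_nat (pi_comp \<alpha>)"] by (simp add: case_prod_unfold)
    also have "\<dots> = (\<Sum>k<?n. \<Sum>\<alpha>\<in>compositions k. ?c V (\<alpha> @ [?n - k]) / of_nat (pi_comp (\<alpha> @ [?n - k])))"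
      by (rule sum.Sigma[symmetric]) (auto simp: finite_compositions)
    also have "\<dots> = (\<Sum>k<?n. \<Sum>\<alpha>\<in>compositions k.
       \<Sum>W | downset P V W \<and> card W = k \<and> has_least P (V - W). ?c W \<alpha> / of_nat (pi_comp \<alpha>) / of_nat ?n)"
      by (intro sum.cong refl snoc) auto
    also have "\<dots> = (\<Sum>k<?n. \<Sum>W | downset P V W \<and> card W = k \<and> has_least P (V - W).
       (\<Sum>\<alpha>\<in>compositions k. ?c W \<alpha> / of_nat (pi_comp \<alpha>)) / of_nat ?n)"
      by (subst sum.swap) (simp add: sum_divide_distrib)
    \<comment> \<open>By induction every ideal \<open>W\<close> contributes 1 /
      \<open>card V\<close>; \<open>coatomic_filters\<close> supplies \<open>card V\<close> of
      them.\<close>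
    also have "\<dots> = (\<Sum>k<?n. \<Sum>W | downset P V W \<and> card W = k \<and> has_least P (V - W). 1 / of_nat ?n)"
    proof (intro sum.cong refl)
      fix k W assume "k \<in> {..<?n}" "W \<in> {W. downset P V W \<and> card W = k \<and> has_least P (V - W)}"
      then show "(\<Sum>\<alpha>\<in>compositions k. ?c W \<alpha> / of_nat (pi_comp \<alpha>)) / of_nat ?n = 1 / of_nat ?n"
        using less.hyps[of W] less.prems by (auto dest: downset_subset finite_subset)
    qed
    also have "\<dots> = (\<Sum>W\<in>(\<Union>k<?n. {W. downset P V W \<and> card W = k \<and> has_least P (V - W)}). 1 / of_nat ?n)"
      by (rule sum.UNION_disjoint[symmetric]) (auto intro: fin)
    also have "(\<Union>k<?n. {W. downset P V W \<and> card W = k \<and> has_least P (V - W)}) =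
        {W. downset P V W \<and> W \<noteq> V \<and> has_least P (V - W)}"
      using less.prems by (auto simp: downset_def intro!: psubset_card_mono)
    also have "(\<Sum>W | downset P V W \<and> W \<noteq> V \<and> has_least P (V - W). 1 / of_nat ?n) = (1::rat)"
      using bij_betw_same_card[OF coatomic_filters[OF assms(2-4), of V]] n by simp
    finally show ?thesis .
  qed
qed

section \<open>Compositions and their refinements\<close>

text \<open>\<open>S_comp\<close> with both endpoints added. Concatenation then becomes union with a
  translate, with no special case at the ends.\<close>

definition partial_sums :: "nat list \<Rightarrow> nat set" where
  "partial_sums \<alpha> = (\<lambda>i. sum_list (take i \<alpha>)) ` {..length \<alpha>}"

lemma zero_in_partial_sums: "0 \<in> partial_sums \<alpha>"
  unfolding partial_sums_def by (rule image_eqI[of _ _ 0]) auto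

lemma sum_list_take_pos:
  fixes \<alpha> :: "nat list"
  assumes "\<forall>a\<in>set \<alpha>. 0 < a" "i < j" "j \<le> length \<alpha>"
  shows "sum_list (take i \<alpha>) < sum_list (take j \<alpha>)"
proof -
  have "take j \<alpha> = take i \<alpha> @ take (j - i) (drop i \<alpha>)"
    using assms by (metis le_add_diff_inverse less_imp_le take_add)
  moreover have "take (j - i) (drop i \<alpha>) \<noteq> []" using assms by simp
  moreover have "\<forall>a\<in>set (take (j - i) (drop i \<alpha>)). 0 < a"
    using assms by (meson in_set_dropD in_set_takeD)
  ultimately have "sum_list (take (j - i) (drop i \<alpha>)) > 0"
    by (metis list.set_intros(1) neq_Nil_conv sum_list_eq_0_iff gr0I less_numeral_extra(3))
  then show ?thesis using \<open>take j \<alpha> = _\<close> by simp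
qed

lemma partial_sums_eq:
  assumes "\<alpha> \<in> compositions n"
  shows "partial_sums \<alpha> = S_comp \<alpha> \<union> {0, n}"
proof -
  have "{..length \<alpha>} = {i. 1 \<le> i \<and> i < length \<alpha>} \<union> {0, length \<alpha>}" by auto
  then show ?thesis unfolding partial_sums_def S_comp_def
    using assms by (auto simp: compositions_def)
qed

lemma S_comp_bounds:
  assumes "\<alpha> \<in> compositions n"
  shows "S_comp \<alpha> \<subseteq> {1..<n}"
proof
  fix x assume "x \<in> S_comp \<alpha>"
  then obtain i where i: "x = sum_list (take i \<alpha>)" "1 \<le> i" "i < length \<alpha>"
    by (auto simp: S_comp_def)
  show "x \<in> {1..<n}"
    using sum_list_take_pos[of \<alpha> 0 i] sum_list_take_pos[of \<alpha> i "length \<alpha>"] i assms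
    by (simp add: compositions_def)
qed

lemma comp_le_iff_partial_sums:
  assumes "\<alpha> \<in> compositions n" "\<beta> \<in> compositions n"
  shows "comp_le \<alpha> \<beta> \<longleftrightarrow> partial_sums \<beta> \<subseteq> partial_sums \<alpha>"
  using S_comp_bounds[OF assms(1)] S_comp_bounds[OF assms(2)]
  unfolding comp_le_def partial_sums_eq[OF assms(1)] partial_sums_eq[OF assms(2)]
  by fastforce

lemma partial_sums_append:
  "partial_sums (\<alpha> @ \<beta>) = partial_sums \<alpha> \<union> (+) (sum_list \<alpha>) ` partial_sums \<beta>"
proof (intro equalityI subsetI)
  fix x assume "x \<in> partial_sums (\<alpha> @ \<beta>)"
  then obtain i where i: "i \<le> length \<alpha> + length \<beta>" "x = sum_list (take i (\<alpha> @ \<beta>))"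
    by (auto simp: partial_sums_def)
  show "x \<in> partial_sums \<alpha> \<union> (+) (sum_list \<alpha>) ` partial_sums \<beta>"
    using i by (cases "i \<le> length \<alpha>") (auto simp: partial_sums_def image_iff)
next
  fix x assume "x \<in> partial_sums \<alpha> \<union> (+) (sum_list \<alpha>) ` partial_sums \<beta>"
  then consider i where "i \<le> length \<alpha>" "x = sum_list (take i \<alpha>)"
    | i where "i \<le> length \<beta>" "x = sum_list \<alpha> + sum_list (take i \<beta>)"
    by (auto simp: partial_sums_def)
  then show "x \<in> partial_sums (\<alpha> @ \<beta>)"
  proof cases
    case 1
    then show ?thesis by (auto simp: partial_sums_def intro!: image_eqI[of _ _ i])
  next
    case 2
    then show ?thesis by (auto simp: partial_sums_def intro!: image_eqI[of _ _ "length \<alpha> + i"])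
  qed
qed

lemma partial_sums_le: "x \<in> partial_sums \<alpha> \<Longrightarrow> x \<le> sum_list \<alpha>"
  unfolding partial_sums_def
  by (auto, metis append_take_drop_id le_add1 sum_list_append)

lemma partial_sums_Cons: "partial_sums (b # bs) = insert 0 ((+) b ` partial_sums bs)"
proof -
  have "partial_sums [b] = {0, b}" by (auto simp: partial_sums_def atMost_Suc)
  moreover have "0 \<in> partial_sums bs" by (rule zero_in_partial_sums)
  ultimately show ?thesis using partial_sums_append[of "[b]" bs] by auto
qed

text \<open>A refinement of \<open>b # bs\<close> has \<open>b\<close> among its partial sums and is
  cut there; positivity of the parts makes the cut unique. This drives the induction over
  \<beta>.\<close>

lemma refinements_Cons:
  assumes "b # bs \<in> compositions n"
  shows "bij_betw (\<lambda>(\<alpha>, \<alpha>'). \<alpha> @ \<alpha>')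
    (compositions b \<times> {\<alpha>' \<in> compositions (n - b). comp_le \<alpha>' bs})
    {\<alpha> \<in> compositions n. comp_le \<alpha> (b # bs)}"
proof -
  have bs: "bs \<in> compositions (n - b)" and b: "0 < b" "b \<le> n"
    using assms by (auto simp: compositions_def)
  have app: "\<alpha> @ \<alpha>' \<in> compositions n" if "\<alpha> \<in> compositions b" "\<alpha>' \<in> compositions (n - b)" for \<alpha> \<alpha>'
    using that b by (auto simp: compositions_def)
  have le: "comp_le (\<alpha> @ \<alpha>') (b # bs) \<longleftrightarrow> comp_le \<alpha>' bs"
    if \<alpha>: "\<alpha> \<in> compositions b" "\<alpha>' \<in> compositions (n - b)" for \<alpha> \<alpha>'
  proof -
    have sb: "sum_list \<alpha> = b" using \<alpha> by (simp add: compositions_def)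
    have 0: "0 \<in> partial_sums \<alpha>" "0 \<in> partial_sums \<alpha>'" by (simp_all add: zero_in_partial_sums)
    \<comment> \<open>The partial sums of \<open>\<alpha>\<close> are at most \<open>b\<close>, so
      they can meet the translate by \<open>b\<close> only at \<open>y = 0\<close>, which lies in
      \<open>partial_sums \<alpha>'\<close> anyway.\<close>
    have "b + y \<in> partial_sums \<alpha> \<union> (+) b ` partial_sums \<alpha>' \<longleftrightarrow> y \<in> partial_sums \<alpha>'" for y
      using partial_sums_le[of "b + y" \<alpha>] 0 sb by auto
    then show ?thesis
      unfolding comp_le_iff_partial_sums[OF app[OF \<alpha>] assms] comp_le_iff_partial_sums[OF \<alpha>(2) bs]
        partial_sums_append partial_sums_Cons sb using 0 by blast
  qed
  show ?thesis
  proof (rule bij_betwI', goal_cases)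
    case (1 x y)
    then obtain a a' c c' where x: "x = (a, a')" "y = (c, c')" "a \<in> compositions b" "c \<in> compositions b"
      by auto
    have "a = c" if eq: "a @ a' = c @ c'"
    proof -
      have *: "\<not> length a < length c" if "a @ a' = c @ c'" "a \<in> compositions b" "c \<in> compositions b" for a a' c c'
      proof
        assume l: "length a < length c"
        then have "a = take (length a) c" using that(1)
          by (metis append_eq_append_conv_if less_imp_le not_le)
        then show False using sum_list_take_pos[of c "length a" "length c"] l that(2,3)
          by (auto simp: compositions_def)
      qed
      have "length a = length c" using *[OF eq x(3,4)] *[OF eq[symmetric] x(4,3)] by simp
      then show ?thesis using eq by simp
    qed
    then show ?case using x by auto
  next
    case (2 x)
    then show ?case using app le by auto
  next
    case (3 \<alpha>)
    then have \<alpha>: "\<alpha> \<in> compositions n" "comp_le \<alpha> (b # bs)" by auto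
    have "0 \<in> partial_sums bs" by (rule zero_in_partial_sums)
    then have "b \<in> partial_sums \<alpha>"
      using \<alpha> comp_le_iff_partial_sums[OF \<alpha>(1) assms] by (auto simp: partial_sums_Cons image_iff)
    then obtain i where i: "b = sum_list (take i \<alpha>)" by (auto simp: partial_sums_def)
    have "sum_list (take i \<alpha>) + sum_list (drop i \<alpha>) = n"
      using \<alpha>(1) unfolding sum_list_append[symmetric] by (simp add: compositions_def)
    then have t: "take i \<alpha> \<in> compositions b" "drop i \<alpha> \<in> compositions (n - b)"
      using \<alpha>(1) i by (auto simp: compositions_def dest: in_set_takeD in_set_dropD)
    then show ?case using le[OF t] \<alpha> by (intro bexI[of _ "(take i \<alpha>, drop i \<alpha>)"]) auto
  qed
qed

text \<open>\<open>comp_blocks\<close> finds the length of the first block by counting prefixes of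
  sum at most \<open>b\<close>. Prefix sums increase strictly, so these are exactly the nonempty
  prefixes of \<open>\<alpha>\<close>.\<close>

lemma pi2_comp_Cons:
  assumes "\<alpha> \<in> compositions b" "\<forall>a\<in>set \<alpha>'. 0 < a"
  shows "pi2_comp (\<alpha> @ \<alpha>') (b # bs) = pi_comp \<alpha> * pi2_comp \<alpha>' bs"
proof -
  let ?l = "\<alpha> @ \<alpha>'"
  have pos: "\<forall>a\<in>set ?l. 0 < a" and sb: "sum_list (take (length \<alpha>) ?l) = b"
    using assms by (auto simp: compositions_def)
  have "sum_list (take j ?l) \<le> b \<longleftrightarrow> j \<le> length \<alpha>" if "j \<le> length ?l" for j
    using sum_list_take_pos[OF pos, of "length \<alpha>" j] sum_list_take_pos[OF pos, of j "length \<alpha>"] that sb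
    by (cases j "length \<alpha>" rule: linorder_cases) (auto simp del: take_append)
  then have "filter (\<lambda>j. sum_list (take j ?l) \<le> b) [1..<Suc (length ?l)] =
      filter (\<lambda>j. j \<le> length \<alpha>) [1..<Suc (length ?l)]"
    by (intro filter_cong) (auto simp del: take_append)
  moreover have "[1..<Suc (length ?l)] = [1..<Suc (length \<alpha>)] @ [Suc (length \<alpha>)..<Suc (length ?l)]"
    using upt_add_eq_append[of 1 "Suc (length \<alpha>)" "length \<alpha>'"] by simp
  moreover have "filter (\<lambda>j. j \<le> length \<alpha>) ([1..<Suc (length \<alpha>)] @ [Suc (length \<alpha>)..<Suc (length ?l)])
      = [1..<Suc (length \<alpha>)]"
    by (auto simp: filter_empty_conv simp del: upt_Suc intro!: filter_True)
  ultimately have "length (filter (\<lambda>j. sum_list (take j ?l) \<le> b) [1..<Suc (length ?l)]) = length \<alpha>"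
    by (simp only: length_upt diff_Suc_1)
  then show ?thesis unfolding pi2_comp_def comp_blocks.simps Let_def by simp
qed

text \<open>The diagonal entries of the triangular system solved in
  \<open>Psi_independent_rat\<close> are nonzero.\<close>

lemma pi2_comp_self_pos:
  assumes "\<forall>a\<in>set \<beta>. 0 < a"
  shows "0 < pi2_comp \<beta> \<beta>"
  using assms
proof (induction \<beta>)
  case Nil
  then show ?case by (simp add: pi2_comp_def)
next
  case (Cons b bs)
  have "pi2_comp ([b] @ bs) (b # bs) = pi_comp [b] * pi2_comp bs bs"
    using Cons.prems by (intro pi2_comp_Cons) (auto simp: compositions_def)
  moreover have "pi_comp [b] = b" by (simp add: pi_comp_def)
  ultimately show ?case using Cons by auto
qed

text \<open>Every part of \<open>\<beta>\<close> is cut into at least one part, and into exactly one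
  only if it is left unchanged. Hence length makes the system for the \<Psi> coefficients
  triangular.\<close>

lemma comp_le_length:
  assumes "\<alpha> \<in> compositions n" "\<beta> \<in> compositions n" "comp_le \<alpha> \<beta>"
  shows "length \<beta> \<le> length \<alpha> \<and> (length \<beta> = length \<alpha> \<longrightarrow> \<alpha> = \<beta>)"
  using assms
proof (induction \<beta> arbitrary: \<alpha> n)
  case Nil
  then have "n = 0" by (simp add: compositions_def)
  then show ?case using Nil by (simp add: compositions_0)
next
  case (Cons b bs)
  obtain a a' where a: "\<alpha> = a @ a'" "a \<in> compositions b" "a' \<in> compositions (n - b)" "comp_le a' bs"
  proof -
    have "\<alpha> \<in> {\<alpha> \<in> compositions n. comp_le \<alpha> (b # bs)}" using Cons.prems by simp
    then show ?thesis
      unfolding bij_betw_imp_surj_on[OF refinements_Cons[OF Cons.prems(2)], symmetric] using that by auto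
  qed
  have "bs \<in> compositions (n - b)" and b: "b > 0"
    using Cons.prems(2) by (auto simp: compositions_def)
  then have IH: "length bs \<le> length a' \<and> (length bs = length a' \<longrightarrow> a' = bs)"
    using Cons.IH a(3,4) by blast
  show ?case
  proof (cases a)
    case Nil
    then show ?thesis using a(2) b by (simp add: compositions_def)
  next
    case (Cons x xs)
    then have "xs = [] \<Longrightarrow> x = b" using a(2) by (simp add: compositions_def)
    then show ?thesis using IH a(1) Cons by (cases xs) auto
  qed
qed

lemma comp_le_refl: "comp_le \<beta> \<beta>"
  by (simp add: comp_le_def)

text \<open>Each block of a chain of type \<open>\<beta>\<close> is refined independently, with
  total weight 1 by \<open>sum_chain_count_pi\<close>. The denominators multiply to
  \<open>pi2_comp\<close>, which is where the coefficients of \<open>Psi_qsym\<close> come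
  in.\<close>

lemma chain_count_refine:
  assumes "finite V" "refl P" "trans P" "antisym P" "\<beta> \<in> compositions (card V)"
  shows "of_nat (chain_count P (\<lambda>_. True) V \<beta>) =
    (\<Sum>\<alpha> | \<alpha> \<in> compositions (card V) \<and> comp_le \<alpha> \<beta>.
       of_nat (chain_count P (has_least P) V \<alpha>) / (of_nat (pi2_comp \<alpha> \<beta>) :: rat))"
  using assms(1,5)
proof (induction \<beta> arbitrary: V)
  case Nil
  then have "V = {}" by (simp add: compositions_def)
  then have "{\<alpha>. \<alpha> \<in> compositions (card V) \<and> comp_le \<alpha> []} = {[]}"
    by (auto simp: compositions_0 comp_le_def S_comp_def)
  then show ?case using \<open>V = {}\<close> by (simp add: pi2_comp_def)
next
  case (Cons b bs)
  let ?c = "\<lambda>V \<alpha>. of_nat (chain_count P (has_least P) V \<alpha>) :: rat"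
  let ?n = "card V"
  have bs: "bs \<in> compositions (?n - b)"
    using Cons.prems by (auto simp: compositions_def)
  let ?R = "{\<alpha> \<in> compositions (?n - b). comp_le \<alpha> bs}"
  have finR: "finite ?R" by (simp add: finite_compositions)
  have cd: "finite W" "card (V - W) = ?n - b" if "downset P V W" "card W = b" for W
  proof -
    show "finite W" using that Cons.prems(1) by (meson downset_subset finite_subset)
    then show "card (V - W) = ?n - b" using that by (simp add: card_Diff_subset downset_subset)
  qed
  have "of_nat (chain_count P (\<lambda>_. True) V (b # bs)) =
     (\<Sum>W | downset P V W \<and> card W = b. of_nat (chain_count P (\<lambda>_. True) (V - W) bs) :: rat)"
    by simp
  \<comment> \<open>The first factor equals 1; inserting it refines the block \<open>W\<close>. The
    second factor comes from the induction hypothesis on the complement.\<close>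
  also have "\<dots> = (\<Sum>W | downset P V W \<and> card W = b.
      (\<Sum>\<alpha>\<in>compositions b. ?c W \<alpha> / of_nat (pi_comp \<alpha>)) *
      (\<Sum>\<alpha>'\<in>?R. ?c (V - W) \<alpha>' / of_nat (pi2_comp \<alpha>' bs)))"
  proof (rule sum.cong[OF refl])
    fix W assume "W \<in> {W. downset P V W \<and> card W = b}"
    then have W: "downset P V W" "card W = b" by auto
    show "of_nat (chain_count P (\<lambda>_. True) (V - W) bs) =
      (\<Sum>\<alpha>\<in>compositions b. ?c W \<alpha> / of_nat (pi_comp \<alpha>)) *
      (\<Sum>\<alpha>'\<in>?R. ?c (V - W) \<alpha>' / of_nat (pi2_comp \<alpha>' bs))"
      using Cons.IH[of "V - W"] bs cd[OF W] Cons.prems(1) W(2)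
        sum_chain_count_pi[OF cd(1)[OF W] assms(2-4)] by simp
  qed
  also have "\<dots> = (\<Sum>W | downset P V W \<and> card W = b. \<Sum>(\<alpha>, \<alpha>')\<in>compositions b \<times> ?R.
      ?c W \<alpha> / of_nat (pi_comp \<alpha>) * (?c (V - W) \<alpha>' / of_nat (pi2_comp \<alpha>' bs)))"
    by (simp add: sum_product sum.cartesian_product)
  also have "\<dots> = (\<Sum>(\<alpha>, \<alpha>')\<in>compositions b \<times> ?R. \<Sum>W | downset P V W \<and> card W = b.
      ?c W \<alpha> / of_nat (pi_comp \<alpha>) * (?c (V - W) \<alpha>' / of_nat (pi2_comp \<alpha>' bs)))"
    unfolding case_prod_unfold by (rule sum.swap)
  also have "\<dots> = (\<Sum>(\<alpha>, \<alpha>')\<in>compositions b \<times> ?R.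
      ?c V (\<alpha> @ \<alpha>') / of_nat (pi2_comp (\<alpha> @ \<alpha>') (b # bs)))"
  proof (rule sum.cong[OF refl], safe, goal_cases)
    case (1 \<alpha> \<alpha>')
    have "pi2_comp (\<alpha> @ \<alpha>') (b # bs) = pi_comp \<alpha> * pi2_comp \<alpha>' bs"
      using 1 by (intro pi2_comp_Cons) (auto simp: compositions_def)
    moreover have "sum_list \<alpha> = b" using 1 by (simp add: compositions_def)
    ultimately show ?case
      by (simp add: chain_count_append[OF Cons.prems(1)] sum_divide_distrib)
  qed
  also have "\<dots> = (\<Sum>\<alpha> | \<alpha> \<in> compositions ?n \<and> comp_le \<alpha> (b # bs).
       ?c V \<alpha> / of_nat (pi2_comp \<alpha> (b # bs)))"
    using sum.reindex_bij_betw[OF refinements_Cons[OF Cons.prems(2)],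
        of "\<lambda>\<alpha>. ?c V \<alpha> / of_nat (pi2_comp \<alpha> (b # bs))"] by (simp add: case_prod_unfold)
  finally show ?case .
qed

section \<open>Expansions over linear extensions\<close>

text \<open>The descent set of the word of labels along \<open>\<sigma>\<close>. The number
  \<open>i\<close> names the gap between the list positions \<open>i - 1\<close> and
  \<open>i\<close>, the same convention as in \<open>F_qsym\<close>.\<close>

definition Des :: "nat \<Rightarrow> (nat \<Rightarrow> int) \<Rightarrow> nat list \<Rightarrow> nat set" where
  "Des n r \<sigma> = {i \<in> {1..<n}. r (\<sigma> ! i) < r (\<sigma> ! (i - 1))}"

definition perms :: "nat \<Rightarrow> nat list set" where
  "perms n = {\<sigma>. distinct \<sigma> \<and> set \<sigma> = {1..n}}"

lemma finite_perms: "finite (perms n)"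
  unfolding perms_def using finite_subset_distinct[of "{1..n}"]
  by (rule rev_finite_subset) auto

lemma length_perms: "\<sigma> \<in> perms n \<Longrightarrow> length \<sigma> = n"
  unfolding perms_def using distinct_card by fastforce

lemma rev_perms: "\<sigma> \<in> perms n \<Longrightarrow> rev \<sigma> \<in> perms n"
  by (simp add: perms_def)

lemma finite_colorings: "finite (colorings_with_content n m)"
proof (cases "colorings_with_content n m = {}")
  case False
  have im: "\<kappa> ` {1..n} = {c. m c \<noteq> 0}" if "\<kappa> \<in> colorings_with_content n m" for \<kappa>
  proof -
    have "m c = card {i \<in> {1..n}. \<kappa> i = c}" for c
      using that by (simp add: colorings_with_content_def)
    then have "m c \<noteq> 0 \<longleftrightarrow> c \<in> \<kappa> ` {1..n}" for c
      by (auto simp: card_eq_0_iff)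
    then show ?thesis by blast
  qed
  with False have "finite {c. m c \<noteq> 0}" by (metis all_not_in_conv finite_imageI finite_atLeastAtMost)
  moreover have "colorings_with_content n m \<subseteq> {1..n} \<rightarrow>\<^sub>E {c. m c \<noteq> 0}"
  proof
    fix \<kappa> assume \<kappa>: "\<kappa> \<in> colorings_with_content n m"
    then have "\<kappa> \<in> extensional {1..n}" by (simp add: colorings_with_content_def PiE_def)
    then show "\<kappa> \<in> {1..n} \<rightarrow>\<^sub>E {c. m c \<noteq> 0}" using im[OF \<kappa>] unfolding PiE_iff by blast
  qed
  ultimately show ?thesis by (meson finite_PiE finite_atLeastAtMost finite_subset)
qed simp

text \<open>In the lexicographic order on pairs, neighbours may share a color exactly when their
  labels do not descend. So the descents are the gaps where the colors are forced to
  increase.\<close>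

lemma sorted_key_iff:
  assumes "\<sigma> \<in> perms n"
  shows "sorted (map (\<lambda>i. (\<kappa> i :: nat, r i)) \<sigma>) \<longleftrightarrow>
    sorted (map \<kappa> \<sigma>) \<and> (\<forall>i\<in>Des n r \<sigma>. map \<kappa> \<sigma> ! (i - 1) < map \<kappa> \<sigma> ! i)"
proof -
  note l = length_perms[OF assms]
  have D: "(\<forall>i\<in>Des n r \<sigma>. map \<kappa> \<sigma> ! (i - 1) < map \<kappa> \<sigma> ! i) \<longleftrightarrow>
    (\<forall>i. Suc i < n \<longrightarrow> r (\<sigma> ! Suc i) < r (\<sigma> ! i) \<longrightarrow> \<kappa> (\<sigma> ! i) < \<kappa> (\<sigma> ! Suc i))" (is "?L \<longleftrightarrow> ?R")
  proof
    show "?L \<Longrightarrow> ?R"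
    proof (intro allI impI)
      fix i assume "?L" "Suc i < n" "r (\<sigma> ! Suc i) < r (\<sigma> ! i)"
      then have "Suc i \<in> Des n r \<sigma>" by (simp add: Des_def)
      then show "\<kappa> (\<sigma> ! i) < \<kappa> (\<sigma> ! Suc i)" using \<open>?L\<close> \<open>Suc i < n\<close> l by fastforce
    qed
    show "?R \<Longrightarrow> ?L"
    proof
      fix i assume R: "?R" and "i \<in> Des n r \<sigma>"
      then obtain k where "i = Suc k" "Suc k < n" "r (\<sigma> ! Suc k) < r (\<sigma> ! k)"
        by (cases i) (auto simp: Des_def)
      then show "map \<kappa> \<sigma> ! (i - 1) < map \<kappa> \<sigma> ! i" using R l by simp
    qed
  qed
  show ?thesis
    unfolding D sorted_iff_nth_Suc length_map l using l
    by (auto simp: less_eq_prod_def not_less)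
qed

text \<open>Reading the colors along \<open>\<sigma>\<close> gives the index sequences of the
  fundamental function. Since \<open>\<sigma>\<close> lists every vertex once, the coloring can be
  recovered and the content is preserved.\<close>

lemma card_colorings_sorted:
  assumes "\<sigma> \<in> perms n"
  shows "of_nat (card {\<kappa> \<in> colorings_with_content n m. sorted (map (\<lambda>i. (\<kappa> i, r i)) \<sigma>)}) =
    F_qsym n (Des n r \<sigma>) m"
proof -
  note l = length_perms[OF assms]
  have d: "distinct \<sigma>" "set \<sigma> = {1..n}" using assms by (auto simp: perms_def)
  let ?pos = "\<lambda>v. (THE i. i < n \<and> \<sigma> ! i = v)"
  have pos: "?pos (\<sigma> ! i) = i" if "i < n" for i
    using that d l by (intro the_equality) (auto simp: nth_eq_iff_index_eq)
  have cnt: "count_list (map \<kappa> \<sigma>) c = card {i \<in> {1..n}. \<kappa> i = c}" for \<kappa> :: "nat \<Rightarrow> nat" and c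
  proof -
    have "count_list (map \<kappa> \<sigma>) c = length (filter (\<lambda>i. \<kappa> i = c) \<sigma>)"
      by (induction \<sigma>) auto
    also have "\<dots> = card (set (filter (\<lambda>i. \<kappa> i = c) \<sigma>))"
      using d(1) by (metis distinct_card distinct_filter)
    also have "set (filter (\<lambda>i. \<kappa> i = c) \<sigma>) = {i \<in> {1..n}. \<kappa> i = c}" using d(2) by auto
    finally show ?thesis .
  qed
  let ?C = "{\<kappa> \<in> colorings_with_content n m. sorted (map (\<lambda>i. (\<kappa> i, r i)) \<sigma>)}"
  let ?J = "{js :: nat list. length js = n \<and> sorted js \<and>
       (\<forall>x\<in>set js. 1 \<le> x) \<and> (\<forall>i\<in>Des n r \<sigma>. js ! (i - 1) < js ! i) \<and>
       (\<forall>c. count_list js c = m c)}"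
  \<comment> \<open>\<open>?pos\<close> inverts \<open>\<sigma>\<close>; the restriction restores
    the value \<open>undefined\<close> that a coloring has outside the vertex set.\<close>
  let ?g = "\<lambda>js. restrict (\<lambda>v. js ! ?pos v) {1..n}"
  have g: "map (?g js) \<sigma> = js" if "length js = n" for js :: "nat list"
    using that l pos d(2) by (intro nth_equalityI) (auto simp: nth_mem)
  have "bij_betw (\<lambda>\<kappa>. map \<kappa> \<sigma>) ?C ?J"
  proof (rule bij_betw_byWitness[where f' = ?g])
    show "\<forall>\<kappa>\<in>?C. ?g (map \<kappa> \<sigma>) = \<kappa>"
    proof
      fix \<kappa> assume "\<kappa> \<in> ?C"
      then have \<kappa>: "\<kappa> \<in> {1..n} \<rightarrow>\<^sub>E {1..}" by (simp add: colorings_with_content_def)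
      show "?g (map \<kappa> \<sigma>) = \<kappa>"
      proof
        fix v
        show "?g (map \<kappa> \<sigma>) v = \<kappa> v"
        proof (cases "v \<in> {1..n}")
          case True
          then obtain i where "i < n" "v = \<sigma> ! i" using d(2) l by (metis in_set_conv_nth)
          then show ?thesis using True pos l by simp
        next
          case False
          then show ?thesis using PiE_arb[OF \<kappa> False] by auto
        qed
      qed
    qed
    show "\<forall>js\<in>?J. map (?g js) \<sigma> = js" using g by blast
    show "(\<lambda>\<kappa>. map \<kappa> \<sigma>) ` ?C \<subseteq> ?J"
      using l d(2) by (auto simp: sorted_key_iff[OF assms] cnt colorings_with_content_def PiE_iff simp del: nth_map)
    show "?g ` ?J \<subseteq> ?C"
    proof
      fix \<kappa> assume "\<kappa> \<in> ?g ` ?J"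
      then obtain js where js: "js \<in> ?J" "\<kappa> = ?g js" by blast
      then have m: "map \<kappa> \<sigma> = js" using g by blast
      have "\<forall>x\<in>\<kappa> ` set \<sigma>. 1 \<le> x" using js(1) unfolding m[symmetric] by simp
      then have "\<kappa> i \<ge> 1" if "i \<in> {1..n}" for i using that d(2) by blast
      then have "\<kappa> \<in> {1..n} \<rightarrow>\<^sub>E {1..}" unfolding PiE_iff using js(2) by simp
      moreover have "card {i \<in> {1..n}. \<kappa> i = c} = m c" for c
        using cnt[of \<kappa> c] js(1) m by simp
      ultimately show "\<kappa> \<in> ?C"
        unfolding mem_Collect_eq sorted_key_iff[OF assms] m using js(1) by (simp add: colorings_with_content_def)
    qed
  qed
  then show ?thesis unfolding F_qsym_def by (simp add: bij_betw_same_card)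
qed

text \<open>Every coloring is sorted, with ties broken by the labels \<open>r\<close>, by exactly one permutation.\<close>

lemma card_colorings_eq_sum_F:
  assumes "inj_on r {1..n}" "L \<subseteq> perms n"
    and "\<And>\<kappa> \<sigma>. \<kappa> \<in> colorings_with_content n m \<Longrightarrow> \<sigma> \<in> perms n \<Longrightarrow>
       sorted (map (\<lambda>i. (\<kappa> i, r i :: int)) \<sigma>) \<Longrightarrow> Q \<kappa> \<longleftrightarrow> \<sigma> \<in> L"
  shows "of_nat (card {\<kappa> \<in> colorings_with_content n m. Q \<kappa>}) = (\<Sum>\<sigma>\<in>L. F_qsym n (Des n r \<sigma>) m)"
proof -
  let ?C = "colorings_with_content n m"
  let ?s = "\<lambda>\<kappa>. sort_key (\<lambda>i. (\<kappa> i, r i)) [1..<Suc n]"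
  let ?X = "\<lambda>\<sigma>. {\<kappa> \<in> ?C. sorted (map (\<lambda>i. (\<kappa> i, r i)) \<sigma>)}"
  have s: "?s \<kappa> \<in> perms n" "sorted (map (\<lambda>i. (\<kappa> i, r i)) (?s \<kappa>))" for \<kappa> :: "nat \<Rightarrow> nat"
    by (auto simp: perms_def simp del: upt_Suc)
  \<comment> \<open>Injectivity of \<open>r\<close> makes the keys pairwise distinct, so only one
    arrangement is sorted.\<close>
  have u: "?s \<kappa> = \<sigma>" if "\<sigma> \<in> perms n" "sorted (map (\<lambda>i. (\<kappa> i, r i)) \<sigma>)" for \<kappa> :: "nat \<Rightarrow> nat" and \<sigma>
  proof (rule sort_key_inj_key_eq[OF _ _ that(2)])
    have "set [1..<Suc n] = {1..n}" by auto
    then show "mset [1..<Suc n] = mset \<sigma>"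
      using that(1) by (metis (mono_tags, lifting) distinct_upt mem_Collect_eq perms_def set_eq_iff_mset_eq_distinct)
    show "inj_on (\<lambda>i. (\<kappa> i, r i)) (set [1..<Suc n])"
      unfolding \<open>set [1..<Suc n] = {1..n}\<close> using assms(1) unfolding inj_on_def by blast
  qed
  have "{\<kappa> \<in> ?C. Q \<kappa>} = (\<Union>\<sigma>\<in>L. ?X \<sigma>)"
    using assms(2,3) s by blast
  also have "card \<dots> = (\<Sum>\<sigma>\<in>L. card (?X \<sigma>))"
  proof (rule card_UN_disjoint)
    show "finite L" using assms(2) finite_perms finite_subset by blast
    show "\<forall>\<sigma>\<in>L. finite (?X \<sigma>)" by (simp add: finite_colorings)
    show "\<forall>\<sigma>\<in>L. \<forall>\<tau>\<in>L. \<sigma> \<noteq> \<tau> \<longrightarrow> ?X \<sigma> \<inter> ?X \<tau> = {}"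
      using u assms(2) by blast
  qed
  finally show ?thesis
    using assms(2) by (auto simp: card_colorings_sorted[symmetric] intro!: sum.cong)
qed

text \<open>For a permutation this is the notion of linear extension, stated on the generating
  relation \<open>A\<close>, which need not be transitive.\<close>

definition increasing_on :: "('a \<times> 'a) set \<Rightarrow> 'a list \<Rightarrow> bool" where
  "increasing_on A \<sigma> \<longleftrightarrow> (\<forall>i<length \<sigma>. \<forall>j<length \<sigma>. (\<sigma> ! i, \<sigma> ! j) \<in> A \<longrightarrow> i < j)"

text \<open>Reversal carries gap \<open>i\<close> to gap \<open>n - i\<close> and exchanges ascents
  with descents; injectivity of \<open>r\<close> excludes a third case.\<close>

lemma Des_rev:
  assumes "\<sigma> \<in> perms n" "inj_on r {1..n}"
  shows "Des n r (rev \<sigma>) = omega_set n (Des n r \<sigma>)"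
proof -
  note l = length_perms[OF assms(1)]
  have d: "distinct \<sigma>" "set \<sigma> = {1..n}" using assms by (auto simp: perms_def)
  have ne: "r (\<sigma> ! i) \<noteq> r (\<sigma> ! j)" if "i < n" "j < n" "i \<noteq> j" for i j
    using that assms(2) d l by (metis inj_onD nth_eq_iff_index_eq nth_mem)
  have "i \<in> Des n r (rev \<sigma>) \<longleftrightarrow> n - i \<notin> Des n r \<sigma>" if i: "i \<in> {1..<n}" for i
  proof -
    have "rev \<sigma> ! i = \<sigma> ! (n - i - 1)" "rev \<sigma> ! (i - 1) = \<sigma> ! (n - i)"
      using i l by (auto simp: rev_nth)
    moreover have "r (\<sigma> ! (n - i)) \<noteq> r (\<sigma> ! (n - i - 1))" using i by (intro ne) auto
    ultimately show ?thesis using i by (auto simp: Des_def)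
  qed
  moreover have "i \<in> (\<lambda>s. n - s) ` Des n r \<sigma> \<longleftrightarrow> n - i \<in> Des n r \<sigma>" if i: "i \<in> {1..<n}" for i
  proof
    assume "i \<in> (\<lambda>s. n - s) ` Des n r \<sigma>"
    then show "n - i \<in> Des n r \<sigma>" by (auto simp: Des_def)
  next
    assume "n - i \<in> Des n r \<sigma>"
    then show "i \<in> (\<lambda>s. n - s) ` Des n r \<sigma>" using i by (intro image_eqI[of _ _ "n - i"]) auto
  qed
  ultimately show ?thesis unfolding omega_set_def by (auto simp: Des_def)
qed

text \<open>As \<open>r\<close> decreases along \<open>A\<close>, ties are broken against \<open>A\<close>: the strict colorings are those sorted
  by the linear extensions of \<open>A\<close>, the weak reversed ones those sorted by their reversals, and
  reversal acts on descent sets as \<open>omega_set\<close>.\<close>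

lemma strict_weak_expansion:
  assumes "inj_on r {1..n}" "A \<subseteq> {1..n} \<times> {1..n}" "\<forall>(i, j)\<in>A. r j < (r i :: int)"
  defines "L \<equiv> {\<sigma> \<in> perms n. increasing_on A \<sigma>}"
  shows "of_nat (card {\<kappa> \<in> colorings_with_content n m. \<forall>(i, j)\<in>A. \<kappa> i < \<kappa> j}) =
      (\<Sum>\<sigma>\<in>L. F_qsym n (Des n r \<sigma>) m)"
    and "of_nat (card {\<kappa> \<in> colorings_with_content n m. \<forall>(i, j)\<in>A. \<kappa> j \<le> \<kappa> i}) =
      (\<Sum>\<sigma>\<in>L. F_qsym n (omega_set n (Des n r \<sigma>)) m)"
proof -
  have adj: "(\<forall>(x, y)\<in>A. R x y) \<longleftrightarrow>
      (\<forall>i<n. \<forall>j<n. (\<sigma> ! i, \<sigma> ! j) \<in> A \<longrightarrow> R (\<sigma> ! i) (\<sigma> ! j))" if "\<sigma> \<in> perms n" for \<sigma> R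
  proof -
    have ex: "\<exists>i<n. x = \<sigma> ! i" if "x \<in> {1..n}" for x
      using that \<open>\<sigma> \<in> perms n\<close> length_perms[OF \<open>\<sigma> \<in> perms n\<close>] unfolding perms_def
      by (metis (mono_tags, lifting) in_set_conv_nth mem_Collect_eq)
    show ?thesis
    proof (intro iffI ballI allI impI; clarify?)
      fix i j assume "\<forall>(x, y)\<in>A. R x y" "(\<sigma> ! i, \<sigma> ! j) \<in> A"
      then show "R (\<sigma> ! i) (\<sigma> ! j)" by blast
    next
      fix x y assume *: "\<forall>i<n. \<forall>j<n. (\<sigma> ! i, \<sigma> ! j) \<in> A \<longrightarrow> R (\<sigma> ! i) (\<sigma> ! j)" "(x, y) \<in> A"
      then have "x \<in> {1..n}" "y \<in> {1..n}" using assms(2) by auto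
      then obtain i j where "i < n" "j < n" "x = \<sigma> ! i" "y = \<sigma> ! j" using ex by blast
      then show "R x y" using * by blast
    qed
  qed
  have le: "\<kappa> (\<sigma> ! i) < \<kappa> (\<sigma> ! j) \<or> \<kappa> (\<sigma> ! i) = \<kappa> (\<sigma> ! j) \<and> r (\<sigma> ! i) \<le> r (\<sigma> ! j)"
    if "\<sigma> \<in> perms n" "sorted (map (\<lambda>i. (\<kappa> i, r i)) \<sigma>)" "i \<le> j" "j < n" for \<kappa> :: "nat \<Rightarrow> nat" and \<sigma> i j
    using sorted_nth_mono[OF that(2,3)] that(3,4) length_perms[OF that(1)] by (auto simp: less_eq_prod_def)
  show "of_nat (card {\<kappa> \<in> colorings_with_content n m. \<forall>(i, j)\<in>A. \<kappa> i < \<kappa> j}) =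
      (\<Sum>\<sigma>\<in>L. F_qsym n (Des n r \<sigma>) m)"
  proof (rule card_colorings_eq_sum_F[OF assms(1)])
    show "L \<subseteq> perms n" by (auto simp: L_def)
    fix \<kappa> :: "nat \<Rightarrow> nat" and \<sigma> assume s: "\<sigma> \<in> perms n" "sorted (map (\<lambda>i. (\<kappa> i, r i)) \<sigma>)"
    \<comment> \<open>The label drops along an edge, so a tie in color places the head before the
      tail. Hence the head has the larger color exactly when the tail comes first.\<close>
    have "\<kappa> (\<sigma> ! i) < \<kappa> (\<sigma> ! j) \<longleftrightarrow> i < j" if ij: "i < n" "j < n" "(\<sigma> ! i, \<sigma> ! j) \<in> A" for i j
    proof -
      have "r (\<sigma> ! j) < r (\<sigma> ! i)" using assms(3) ij by blast
      then show ?thesis using le[OF s, of i j] le[OF s, of j i] ij by (cases "i < j") auto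
    qed
    then show "(\<forall>(i, j)\<in>A. \<kappa> i < \<kappa> j) \<longleftrightarrow> \<sigma> \<in> L"
      unfolding adj[OF s(1)] L_def increasing_on_def using s(1) length_perms[OF s(1)] by auto
  qed
  have "of_nat (card {\<kappa> \<in> colorings_with_content n m. \<forall>(i, j)\<in>A. \<kappa> j \<le> \<kappa> i}) =
      (\<Sum>\<sigma>\<in>rev ` L. F_qsym n (Des n r \<sigma>) m)"
  proof (rule card_colorings_eq_sum_F[OF assms(1)])
    show "rev ` L \<subseteq> perms n" using rev_perms unfolding L_def by blast
    fix \<kappa> :: "nat \<Rightarrow> nat" and \<sigma> assume s: "\<sigma> \<in> perms n" "sorted (map (\<lambda>i. (\<kappa> i, r i)) \<sigma>)"
    note l = length_perms[OF s(1)]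
    have r: "r (\<sigma> ! j) < r (\<sigma> ! i)" if "(\<sigma> ! i, \<sigma> ! j) \<in> A" for i j using assms(3) that by blast
    \<comment> \<open>By the same tie rule, the color of the head is at most that of the tail
      exactly when the head comes first.\<close>
    have iff: "\<kappa> (\<sigma> ! j) \<le> \<kappa> (\<sigma> ! i) \<longleftrightarrow> j < i" if ij: "i < n" "j < n" "(\<sigma> ! i, \<sigma> ! j) \<in> A" for i j
      using r[OF ij(3)] le[OF s, of i j] le[OF s, of j i] ij by (cases "j < i") auto
    have rev: "(\<forall>i<n. \<forall>j<n. R (rev \<sigma> ! i) (rev \<sigma> ! j) \<longrightarrow> i < j) \<longleftrightarrow>
        (\<forall>i<n. \<forall>j<n. R (\<sigma> ! i) (\<sigma> ! j) \<longrightarrow> j < i)" (is "?a \<longleftrightarrow> ?b") for R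
    proof
      assume a: ?a
      show ?b
      proof (intro allI impI)
        fix i j assume ij: "i < n" "j < n" "R (\<sigma> ! i) (\<sigma> ! j)"
        then have "n - 1 - i < n - 1 - j"
          using a[rule_format, of "n - 1 - i" "n - 1 - j"] l by (auto simp: rev_nth)
        then show "j < i" by simp
      qed
    next
      assume b: ?b
      show ?a
      proof (intro allI impI)
        fix i j assume ij: "i < n" "j < n" "R (rev \<sigma> ! i) (rev \<sigma> ! j)"
        then have "n - 1 - j < n - 1 - i"
          using b[rule_format, of "n - 1 - i" "n - 1 - j"] l by (auto simp: rev_nth)
        then show "i < j" by simp
      qed
    qed
    have "\<sigma> \<in> rev ` L \<longleftrightarrow> rev \<sigma> \<in> L" by (metis image_iff rev_rev_ident)
    also have "\<dots> \<longleftrightarrow> increasing_on A (rev \<sigma>)" using s(1) by (simp add: L_def rev_perms)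
    also have "\<dots> \<longleftrightarrow> (\<forall>i<n. \<forall>j<n. (\<sigma> ! i, \<sigma> ! j) \<in> A \<longrightarrow> j < i)"
      unfolding increasing_on_def length_rev l using rev[of "\<lambda>x y. (x, y) \<in> A"] .
    finally show "(\<forall>(i, j)\<in>A. \<kappa> j \<le> \<kappa> i) \<longleftrightarrow> \<sigma> \<in> rev ` L"
      unfolding adj[OF s(1)] using iff by auto
  qed
  also have "\<dots> = (\<Sum>\<sigma>\<in>L. F_qsym n (Des n r (rev \<sigma>)) m)"
    by (subst sum.reindex) auto
  also have "\<dots> = (\<Sum>\<sigma>\<in>L. F_qsym n (omega_set n (Des n r \<sigma>)) m)"
    by (intro sum.cong) (auto simp: L_def Des_rev[OF _ assms(1)])
  finally show "of_nat (card {\<kappa> \<in> colorings_with_content n m. \<forall>(i, j)\<in>A. \<kappa> j \<le> \<kappa> i}) =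
      (\<Sum>\<sigma>\<in>L. F_qsym n (omega_set n (Des n r \<sigma>)) m)" .
qed

section \<open>Monotone colorings and the functions \<open>\<Psi>\<^sub>\<alpha>\<close>\<close>

text \<open>As the parts are positive, an index list contributing to \<open>m\<close> must enumerate
  the support of \<open>m\<close> increasingly, so at most one list is counted. The condition
  \<open>m 0 = 0\<close> reflects that the variables start at x_1.\<close>

lemma M_qsym_eq:
  assumes "\<forall>a\<in>set \<beta>. 0 < a"
  shows "M_qsym \<beta> m = (if finite {c. m c \<noteq> 0} \<and> m 0 = 0 \<and> \<beta> = map m (sorted_list_of_set {c. m c \<noteq> 0}) then 1 else 0)"
proof -
  let ?S = "{c. m c \<noteq> 0}"
  let ?X = "{idx :: nat list. length idx = length \<beta> \<and> sorted_wrt (<) idx \<and> (\<forall>i\<in>set idx. 1 \<le> i) \<and>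
       (\<forall>c. m c = sum_list [\<beta> ! k. k \<leftarrow> [0..<length \<beta>], idx ! k = c])}"
  have sum: "sum_list [\<beta> ! k. k \<leftarrow> [0..<length \<beta>], idx ! k = c] = (\<Sum>k<length \<beta>. if idx ! k = c then \<beta> ! k else 0)"
    for idx :: "nat list" and c
  proof -
    have "sum_list (concat (map (\<lambda>k. if idx ! k = c then [\<beta> ! k] else []) ks)) =
      sum_list (map (\<lambda>k. if idx ! k = c then \<beta> ! k else 0) ks)" for ks
      by (induction ks) auto
    then show ?thesis by (simp add: interv_sum_list_conv_sum_set_nat atLeast0LessThan)
  qed
  have val: "(\<Sum>j<length \<beta>. if idx ! j = idx ! k then \<beta> ! j else 0) = \<beta> ! k"
    if "length idx = length \<beta>" "sorted_wrt (<) idx" "k < length \<beta>" for idx :: "nat list" and k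
  proof -
    have "distinct idx" using that(2) strict_sorted_iff by blast
    then have "(\<Sum>j<length \<beta>. if idx ! j = idx ! k then \<beta> ! j else 0) = (\<Sum>j<length \<beta>. if j = k then \<beta> ! j else 0)"
      using that by (intro sum.cong) (auto simp: nth_eq_iff_index_eq)
    then show ?thesis using that(3) by simp
  qed
  have val0: "(\<Sum>j<length \<beta>. if idx ! j = c then \<beta> ! j else 0) = 0"
    if "length idx = length \<beta>" "c \<notin> set idx" for idx :: "nat list" and c
    using that by (intro sum.neutral) auto
  have "?X = (if finite ?S \<and> m 0 = 0 \<and> \<beta> = map m (sorted_list_of_set ?S) then {sorted_list_of_set ?S} else {})"
  proof (intro equalityI subsetI)
    fix idx assume "idx \<in> ?X"
    then have i: "length idx = length \<beta>" "sorted_wrt (<) idx" "\<forall>i\<in>set idx. 1 \<le> i"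
      "\<And>c. m c = (\<Sum>k<length \<beta>. if idx ! k = c then \<beta> ! k else 0)"
      unfolding sum by auto
    have mk: "m (idx ! k) = \<beta> ! k" if "k < length \<beta>" for k
      using val[OF i(1,2) that] i(4) by simp
    have S: "?S = set idx"
    proof (intro equalityI subsetI)
      fix c assume "c \<in> ?S"
      then have "m c \<noteq> 0" by simp
      then show "c \<in> set idx" unfolding i(4)[of c] using val0[OF i(1)] by metis
    next
      fix c assume "c \<in> set idx"
      then obtain k where "k < length \<beta>" "c = idx ! k" using i(1) unfolding in_set_conv_nth by auto
      then show "c \<in> ?S" using mk assms by (auto simp: nth_mem)
    qed
    have "sorted_list_of_set ?S = idx"
      unfolding S using i(2) by (metis strict_sorted_iff sorted_list_of_set.idem_if_sorted_distinct)
    moreover have "\<beta> = map m idx" using i(1) mk by (intro nth_equalityI) auto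
    moreover have "m 0 = 0" using i(3) S by fastforce
    ultimately show "idx \<in> (if finite ?S \<and> m 0 = 0 \<and> \<beta> = map m (sorted_list_of_set ?S) then {sorted_list_of_set ?S} else {})"
      using S by auto
  next
    fix idx assume "idx \<in> (if finite ?S \<and> m 0 = 0 \<and> \<beta> = map m (sorted_list_of_set ?S) then {sorted_list_of_set ?S} else {})"
    then have i: "finite ?S" "m 0 = 0" "\<beta> = map m idx" "idx = sorted_list_of_set ?S"
      by (auto split: if_splits)
    have set: "set idx = ?S" "sorted_wrt (<) idx" "length idx = length \<beta>" using i by auto
    have "m c = (\<Sum>k<length \<beta>. if idx ! k = c then \<beta> ! k else 0)" for c
    proof (cases "c \<in> set idx")
      case True
      then obtain k where k: "k < length \<beta>" "c = idx ! k" using set(3) unfolding in_set_conv_nth by auto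
      have "\<beta> ! k = m c" by (subst i(3)) (use k set(3) in simp)
      then show ?thesis using val[OF set(3,2) k(1)] k(2) by simp
    next
      case False
      then show ?thesis using val0[OF set(3), of c] set(1) by simp
    qed
    moreover have "\<forall>i\<in>set idx. 1 \<le> i" using set(1) i(2) by (auto simp: Suc_le_eq intro: gr0I)
    ultimately show "idx \<in> ?X" unfolding sum using set by auto
  qed
  then show ?thesis unfolding M_qsym_def by auto
qed

text \<open>Vertex set and color set are arbitrary so that an induction can remove the least color
  together with its class.\<close>

definition monotone_colorings :: "(nat \<times> nat) set \<Rightarrow> nat set \<Rightarrow> (nat \<Rightarrow> nat) \<Rightarrow> nat set \<Rightarrow> (nat \<Rightarrow> nat) set" where
  "monotone_colorings P V m C = {\<kappa> \<in> V \<rightarrow>\<^sub>E C. (\<forall>c\<in>C. card {v \<in> V. \<kappa> v = c} = m c) \<and>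
     (\<forall>x\<in>V. \<forall>y\<in>V. (x, y) \<in> P \<longrightarrow> \<kappa> x \<le> \<kappa> y)}"

lemma finite_monotone_colorings:
  assumes "finite V" "finite C"
  shows "finite (monotone_colorings P V m C)"
proof (rule finite_subset)
  show "monotone_colorings P V m C \<subseteq> V \<rightarrow>\<^sub>E C" unfolding monotone_colorings_def by blast
  show "finite (V \<rightarrow>\<^sub>E C)" using assms by (intro finite_PiE)
qed

text \<open>The class of the least color is an ideal: an element below it has a color no larger,
  hence the same.\<close>

lemma monotone_colorings_insert:
  assumes "\<forall>c'\<in>C. c < c'"
  shows "bij_betw (\<lambda>\<kappa>. ({v \<in> V. \<kappa> v = c}, restrict \<kappa> (V - {v \<in> V. \<kappa> v = c})))
    (monotone_colorings P V m (insert c C))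
    (SIGMA U:{U. downset P V U \<and> card U = m c}. monotone_colorings P (V - U) m C)"
    (is "bij_betw ?f ?A ?B")
proof (rule bij_betw_byWitness[where f' = "\<lambda>(U, \<kappa>) v. if v \<in> U then c else \<kappa> v"])
  show "\<forall>\<kappa>\<in>?A. (case ?f \<kappa> of (U, \<kappa>) \<Rightarrow> \<lambda>v. if v \<in> U then c else \<kappa> v) = \<kappa>"
  proof
    fix \<kappa> assume "\<kappa> \<in> ?A"
    then have "\<kappa> \<in> V \<rightarrow>\<^sub>E insert c C" unfolding monotone_colorings_def by blast
    then have "\<kappa> v = undefined" if "v \<notin> V" for v using PiE_arb that by metis
    then show "(case ?f \<kappa> of (U, \<kappa>) \<Rightarrow> \<lambda>v. if v \<in> U then c else \<kappa> v) = \<kappa>"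
      by (auto simp: fun_eq_iff)
  qed
  show "\<forall>x\<in>?B. ?f (case x of (U, \<kappa>) \<Rightarrow> \<lambda>v. if v \<in> U then c else \<kappa> v) = x"
  proof
    fix x assume "x \<in> ?B"
    then obtain U \<kappa> where x: "x = (U, \<kappa>)" and U: "downset P V U"
      and \<kappa>: "\<kappa> \<in> monotone_colorings P (V - U) m C" by blast
    have \<kappa>E: "\<kappa> \<in> V - U \<rightarrow>\<^sub>E C" using \<kappa> by (simp add: monotone_colorings_def)
    have UV: "U \<subseteq> V" using U by (rule downset_subset)
    have "{v \<in> V. (if v \<in> U then c else \<kappa> v) = c} = U"
    proof -
      have "\<kappa> v \<noteq> c" if "v \<in> V - U" for v using PiE_mem[OF \<kappa>E that] assms by blast
      then show ?thesis using UV by auto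
    qed
    moreover have "restrict (\<lambda>v. if v \<in> U then c else \<kappa> v) (V - U) = \<kappa>"
    proof
      fix v show "restrict (\<lambda>v. if v \<in> U then c else \<kappa> v) (V - U) v = \<kappa> v"
        using PiE_arb[OF \<kappa>E, of v] by (cases "v \<in> V - U") auto
    qed
    ultimately show "?f (case x of (U, \<kappa>) \<Rightarrow> \<lambda>v. if v \<in> U then c else \<kappa> v) = x"
      unfolding x by simp
  qed
  show "?f ` ?A \<subseteq> ?B"
  proof (rule image_subsetI)
    fix \<kappa> assume "\<kappa> \<in> ?A"
    then have E: "\<And>v. v \<in> V \<Longrightarrow> \<kappa> v \<in> insert c C"
      and cc: "\<forall>c'\<in>insert c C. card {v \<in> V. \<kappa> v = c'} = m c'"
      and mono: "\<forall>x\<in>V. \<forall>y\<in>V. (x, y) \<in> P \<longrightarrow> \<kappa> x \<le> \<kappa> y"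
      by (auto simp: monotone_colorings_def)
    let ?U = "{v \<in> V. \<kappa> v = c}"
    have ge: "c \<le> \<kappa> v" if "v \<in> V" for v using E[OF that] assms by auto
    have "downset P V ?U" unfolding downset_def using mono ge by force
    moreover have "{v \<in> V - ?U. restrict \<kappa> (V - ?U) v = c'} = {v \<in> V. \<kappa> v = c'}" if "c' \<in> C" for c'
      using that assms by auto
    moreover have "restrict \<kappa> (V - ?U) \<in> V - ?U \<rightarrow>\<^sub>E C" using E by auto
    ultimately show "?f \<kappa> \<in> ?B" using cc mono by (auto simp: monotone_colorings_def)
  qed
  show "(\<lambda>(U, \<kappa>) v. if v \<in> U then c else \<kappa> v) ` ?B \<subseteq> ?A"
  proof (rule image_subsetI)
    fix x assume "x \<in> ?B"
    then obtain U \<kappa> where x: "x = (U, \<kappa>)" and U: "downset P V U" "card U = m c"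
      and "\<kappa> \<in> monotone_colorings P (V - U) m C" by blast
    then have E: "\<kappa> \<in> V - U \<rightarrow>\<^sub>E C" and cc: "\<forall>c\<in>C. card {v \<in> V - U. \<kappa> v = c} = m c"
      and mono: "\<forall>x\<in>V - U. \<forall>y\<in>V - U. (x, y) \<in> P \<longrightarrow> \<kappa> x \<le> \<kappa> y"
      by (auto simp: monotone_colorings_def)
    let ?k = "\<lambda>v. if v \<in> U then c else \<kappa> v"
    have UV: "U \<subseteq> V" using U(1) by (rule downset_subset)
    have gt: "c < \<kappa> v" if "v \<in> V - U" for v using PiE_mem[OF E that] assms by blast
    have "?k \<in> V \<rightarrow>\<^sub>E insert c C"
    proof (rule PiE_I)
      fix v assume "v \<in> V"
      then show "?k v \<in> insert c C" using PiE_mem[OF E, of v] by auto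
    next
      fix v assume "v \<notin> V"
      then show "?k v = undefined" using PiE_arb[OF E, of v] UV by auto
    qed
    moreover have "{v \<in> V. ?k v = c} = U" using UV less_imp_neq[OF gt] by auto
    moreover have "{v \<in> V. ?k v = c'} = {v \<in> V - U. \<kappa> v = c'}" if "c' \<in> C" for c'
      using that assms by auto
    moreover have "?k x \<le> ?k y" if "x \<in> V" "y \<in> V" "(x, y) \<in> P" for x y
      using that mono gt[of y] U(1) by (auto simp: downset_def less_imp_le)
    ultimately have "?k \<in> ?A" using cc U(2) by (simp add: monotone_colorings_def)
    then show "(case x of (U, \<kappa>) \<Rightarrow> \<lambda>v. if v \<in> U then c else \<kappa> v) \<in> ?A" unfolding x by simp
  qed
qed

text \<open>The color classes, taken by increasing color, are the blocks of a chain of ideals, with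
  no condition on the single blocks.\<close>

lemma card_monotone_colorings:
  assumes "finite V" "sorted_wrt (<) idx"
  shows "card (monotone_colorings P V m (set idx)) = chain_count P (\<lambda>_. True) V (map m idx)"
  using assms
proof (induction idx arbitrary: V)
  case Nil
  show ?case
  proof (cases "V = {}")
    case True
    then have "monotone_colorings P V m (set []) = {\<lambda>_. undefined}"
      by (auto simp: monotone_colorings_def)
    then show ?thesis using True by simp
  next
    case False
    then have "monotone_colorings P V m (set []) = {}"
      by (auto simp: monotone_colorings_def PiE_iff)
    then show ?thesis using False by simp
  qed
next
  case (Cons c cs)
  have "card (monotone_colorings P V m (set (c # cs))) =
    card (SIGMA U:{U. downset P V U \<and> card U = m c}. monotone_colorings P (V - U) m (set cs))"
    using bij_betw_same_card[OF monotone_colorings_insert[of "set cs" c V P m]] Cons.prems(2) by simp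
  also have "\<dots> = (\<Sum>U | downset P V U \<and> card U = m c. card (monotone_colorings P (V - U) m (set cs)))"
    using Cons.prems(1) by (intro card_SigmaI finite_downsets ballI finite_monotone_colorings) auto
  finally show ?case using Cons by simp
qed

lemma colorings_flatten:
  assumes "\<kappa> \<in> colorings_with_content n m"
  shows "\<kappa> ` {1..n} = {c. m c \<noteq> 0}" "finite {c. m c \<noteq> 0}" "m 0 = 0"
    "map m (sorted_list_of_set {c. m c \<noteq> 0}) \<in> compositions n"
proof -
  have m: "m c = card {i \<in> {1..n}. \<kappa> i = c}" for c
    using assms by (simp add: colorings_with_content_def)
  have "m c \<noteq> 0 \<longleftrightarrow> c \<in> \<kappa> ` {1..n}" for c
    unfolding m by (auto simp: card_eq_0_iff)
  then show im: "\<kappa> ` {1..n} = {c. m c \<noteq> 0}" by blast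
  then show fin: "finite {c. m c \<noteq> 0}" by (metis finite_imageI finite_atLeastAtMost)
  have "0 \<notin> \<kappa> ` {1..n}" using assms by (auto simp: colorings_with_content_def PiE_iff)
  then show "m 0 = 0" using im by blast
  have "(\<Sum>c | m c \<noteq> 0. m c) = (\<Sum>c | m c \<noteq> 0. \<Sum>i\<in>{i \<in> {1..n}. \<kappa> i = c}. 1)"
    by (simp add: m)
  also have "\<dots> = (\<Sum>i\<in>{1..n}. 1)" using fin im by (intro sum.group) auto
  finally have "sum_list (map m (sorted_list_of_set {c. m c \<noteq> 0})) = n"
    using fin by (simp add: sum_list_distinct_conv_sum_set)
  then show "map m (sorted_list_of_set {c. m c \<noteq> 0}) \<in> compositions n"
    using fin by (auto simp: compositions_def)
qed

lemma Psi_over_z: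
  assumes "\<alpha> \<in> compositions n"
  shows "Psi_qsym \<alpha> m / of_nat (z_comp \<alpha>) =
    (\<Sum>\<beta> | \<beta> \<in> compositions n \<and> comp_le \<alpha> \<beta>. M_qsym \<beta> m / of_nat (pi2_comp \<alpha> \<beta>))"
proof -
  have "z_comp \<alpha> \<noteq> 0" using assms by (auto simp: z_comp_def compositions_def)
  then show ?thesis using assms by (simp add: Psi_qsym_def compositions_def)
qed

text \<open>Change of basis to the monomial functions, used both for the existence of the expansion
  and for its uniqueness.\<close>

lemma Psi_expansion_eq:
  "(\<Sum>\<alpha>\<in>compositions n. c \<alpha> * (Psi_qsym \<alpha> m / of_nat (z_comp \<alpha>))) =
   (\<Sum>\<beta>\<in>compositions n. M_qsym \<beta> m *
      (\<Sum>\<alpha> | \<alpha> \<in> compositions n \<and> comp_le \<alpha> \<beta>. c \<alpha> / of_nat (pi2_comp \<alpha> \<beta>)))"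
proof -
  note fin = finite_compositions[of n]
  have "(\<Sum>\<alpha>\<in>compositions n. c \<alpha> * (Psi_qsym \<alpha> m / of_nat (z_comp \<alpha>))) =
    (\<Sum>\<alpha>\<in>compositions n. \<Sum>\<beta>\<in>compositions n.
       if comp_le \<alpha> \<beta> then M_qsym \<beta> m * (c \<alpha> / of_nat (pi2_comp \<alpha> \<beta>)) else 0)"
  proof (rule sum.cong[OF refl])
    fix \<alpha> assume "\<alpha> \<in> compositions n"
    then show "c \<alpha> * (Psi_qsym \<alpha> m / of_nat (z_comp \<alpha>)) =
       (\<Sum>\<beta>\<in>compositions n. if comp_le \<alpha> \<beta> then M_qsym \<beta> m * (c \<alpha> / of_nat (pi2_comp \<alpha> \<beta>)) else 0)"
      using fin by (simp add: Psi_over_z sum_distrib_left sum.inter_filter[symmetric] algebra_simps)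
  qed
  also have "\<dots> = (\<Sum>\<beta>\<in>compositions n. \<Sum>\<alpha>\<in>compositions n.
       if comp_le \<alpha> \<beta> then M_qsym \<beta> m * (c \<alpha> / of_nat (pi2_comp \<alpha> \<beta>)) else 0)"
    by (rule sum.swap)
  finally show ?thesis
    using fin by (simp add: sum_distrib_left sum.inter_filter if_distrib cong: if_cong)
qed

lemma sum_M_qsym:
  assumes "finite {c. m c \<noteq> 0}" "m 0 = 0" "map m (sorted_list_of_set {c. m c \<noteq> 0}) \<in> compositions n"
  shows "(\<Sum>\<beta>\<in>compositions n. M_qsym \<beta> m * w \<beta>) = w (map m (sorted_list_of_set {c. m c \<noteq> 0}))"
proof -
  define b where "b = map m (sorted_list_of_set {c. m c \<noteq> 0})"
  have "M_qsym \<beta> m = (if \<beta> = b then 1 else 0)" if "\<beta> \<in> compositions n" for \<beta>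
  proof -
    have "\<forall>a\<in>set \<beta>. 0 < a" using that by (simp add: compositions_def)
    then show ?thesis unfolding b_def using assms(1,2) by (simp only: M_qsym_eq simp_thms)
  qed
  then have "(\<Sum>\<beta>\<in>compositions n. M_qsym \<beta> m * w \<beta>) = (\<Sum>\<beta>\<in>compositions n. if \<beta> = b then w b else 0)"
    by (intro sum.cong refl) simp
  then show ?thesis using assms(3) finite_compositions unfolding b_def[symmetric] by simp
qed

text \<open>Both sides have the same monomial coefficients, the numbers of chains with arbitrary
  blocks: on the left the blocks are color classes, on the right \<open>chain_count_refine\<close>
  applies.\<close>

lemma monotone_colorings_Psi:
  assumes "refl P" "trans P" "antisym P"
  shows "of_nat (card {\<kappa> \<in> colorings_with_content n m. \<forall>x\<in>{1..n}. \<forall>y\<in>{1..n}. (x, y) \<in> P \<longrightarrow> \<kappa> x \<le> \<kappa> y}) =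
    (\<Sum>\<alpha>\<in>compositions n. of_nat (chain_count P (has_least P) {1..n} \<alpha>) *
       (Psi_qsym \<alpha> m / of_nat (z_comp \<alpha>)))"
proof -
  let ?S = "{c. m c \<noteq> 0}"
  let ?idx = "sorted_list_of_set ?S"
  let ?X = "{\<kappa> \<in> colorings_with_content n m. \<forall>x\<in>{1..n}. \<forall>y\<in>{1..n}. (x, y) \<in> P \<longrightarrow> \<kappa> x \<le> \<kappa> y}"
  let ?w = "\<lambda>\<beta>. of_nat (chain_count P (\<lambda>_. True) {1..n} \<beta>) :: rat"
  have w: "(\<Sum>\<alpha> | \<alpha> \<in> compositions n \<and> comp_le \<alpha> \<beta>.
     of_nat (chain_count P (has_least P) {1..n} \<alpha>) / of_nat (pi2_comp \<alpha> \<beta>)) = ?w \<beta>"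
    if "\<beta> \<in> compositions n" for \<beta>
    using chain_count_refine[of "{1..n}" P \<beta>] assms that by simp
  have "(\<Sum>\<alpha>\<in>compositions n. of_nat (chain_count P (has_least P) {1..n} \<alpha>) *
       (Psi_qsym \<alpha> m / of_nat (z_comp \<alpha>))) = (\<Sum>\<beta>\<in>compositions n. M_qsym \<beta> m * ?w \<beta>)"
    unfolding Psi_expansion_eq by (intro sum.cong refl) (simp only: w)
  also have "\<dots> = of_nat (card ?X)"
  proof (cases "finite ?S \<and> m 0 = 0 \<and> map m ?idx \<in> compositions n")
    case True
    then have fin: "finite ?S" by simp
    have "?X = monotone_colorings P {1..n} m (set ?idx)"
    proof (intro equalityI subsetI)
      fix \<kappa> assume "\<kappa> \<in> ?X"
      moreover then have "\<kappa> ` {1..n} = ?S" by (intro colorings_flatten(1)) simp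
      ultimately show "\<kappa> \<in> monotone_colorings P {1..n} m (set ?idx)"
        using fin by (auto simp: monotone_colorings_def colorings_with_content_def PiE_iff)
    next
      fix \<kappa> assume "\<kappa> \<in> monotone_colorings P {1..n} m (set ?idx)"
      then have \<kappa>: "\<kappa> \<in> {1..n} \<rightarrow>\<^sub>E ?S" "\<forall>c\<in>?S. card {v \<in> {1..n}. \<kappa> v = c} = m c"
        "\<forall>x\<in>{1..n}. \<forall>y\<in>{1..n}. (x, y) \<in> P \<longrightarrow> \<kappa> x \<le> \<kappa> y"
        using fin by (auto simp: monotone_colorings_def)
      have "card {v \<in> {1..n}. \<kappa> v = c} = m c" for c
      proof (cases "c \<in> ?S")
        case False
        then have "{v \<in> {1..n}. \<kappa> v = c} = {}" using PiE_mem[OF \<kappa>(1)] by blast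
        then show ?thesis using False by (metis (mono_tags, lifting) card.empty mem_Collect_eq)
      qed (use \<kappa>(2) in blast)
      moreover have "\<kappa> v \<in> {1..}" if "v \<in> {1..n}" for v
        using PiE_mem[OF \<kappa>(1) that] True by (cases "\<kappa> v") auto
      then have "\<kappa> \<in> {1..n} \<rightarrow>\<^sub>E {1..}" using \<kappa>(1) unfolding PiE_iff by blast
      ultimately show "\<kappa> \<in> ?X" using \<kappa>(3) by (simp add: colorings_with_content_def)
    qed
    then have "card ?X = chain_count P (\<lambda>_. True) {1..n} (map m ?idx)"
      using card_monotone_colorings[of "{1..n}" ?idx P m] by simp
    then show ?thesis using True by (simp add: sum_M_qsym)
  next
    case False
    then have "colorings_with_content n m = {}" using colorings_flatten by blast
    moreover have "M_qsym \<beta> m = 0" if "\<beta> \<in> compositions n" for \<beta>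
      using that False M_qsym_eq[of \<beta> m] by (auto simp: compositions_def)
    ultimately show ?thesis by simp
  qed
  finally show ?thesis by simp
qed

section \<open>Triangularity of the \<Psi> functions and uniqueness of their coefficients\<close>

definition composition_monomial :: "nat list \<Rightarrow> nat \<Rightarrow> nat" where
  "composition_monomial \<beta> c = (if 1 \<le> c \<and> c \<le> length \<beta> then \<beta> ! (c - 1) else 0)"

text \<open>The exponents of x_1, x_2, ... are the parts of \<open>\<beta>\<close> in order. On this
  monomial the function M of \<open>\<beta>\<close> is 1, and that of any other composition of the
  same number is 0.\<close>

lemma composition_monomial_flatten:
  assumes "\<forall>b\<in>set \<beta>. 0 < b"
  shows "finite {c. composition_monomial \<beta> c \<noteq> 0}" "composition_monomial \<beta> 0 = 0"
    "map (composition_monomial \<beta>) (sorted_list_of_set {c. composition_monomial \<beta> c \<noteq> 0}) = \<beta>"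
proof -
  have S: "{c. composition_monomial \<beta> c \<noteq> 0} = {1..<Suc (length \<beta>)}"
    using assms by (auto simp: composition_monomial_def Suc_le_eq nth_mem split: if_splits)
  show "finite {c. composition_monomial \<beta> c \<noteq> 0}" unfolding S by simp
  show "composition_monomial \<beta> 0 = 0" by (simp add: composition_monomial_def)
  show "map (composition_monomial \<beta>) (sorted_list_of_set {c. composition_monomial \<beta> c \<noteq> 0}) = \<beta>"
    unfolding S sorted_list_of_set_range
    by (rule nth_equalityI) (simp_all add: composition_monomial_def del: upt_Suc)
qed

lemma length_composition: "\<beta> \<in> compositions n \<Longrightarrow> length \<beta> \<le> n"
proof -
  have "length \<beta> \<le> sum_list \<beta>" if "\<forall>b\<in>set \<beta>. 0 < b" using that by (induction \<beta>) auto
  then show "\<beta> \<in> compositions n \<Longrightarrow> length \<beta> \<le> n" by (auto simp: compositions_def)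
qed

text \<open>The coefficient of M_\<beta> involves only refinements of \<open>\<beta>\<close>, and
  these are longer unless equal to it. So the coefficients vanish one after another, starting from
  the longest composition.\<close>

lemma Psi_independent_rat:
  fixes c :: "nat list \<Rightarrow> rat"
  assumes "\<forall>m. (\<Sum>\<alpha>\<in>compositions n. c \<alpha> * (Psi_qsym \<alpha> m / of_nat (z_comp \<alpha>))) = 0"
    and "\<beta> \<in> compositions n"
  shows "c \<beta> = 0"
  using assms(2)
proof (induction "n - length \<beta>" arbitrary: \<beta> rule: less_induct)
  case less
  note fl = composition_monomial_flatten[of \<beta>]
  have pos: "\<forall>b\<in>set \<beta>. 0 < b" using less.prems by (simp add: compositions_def)
  have "(\<Sum>\<alpha> | \<alpha> \<in> compositions n \<and> comp_le \<alpha> \<beta>. c \<alpha> / of_nat (pi2_comp \<alpha> \<beta>)) = 0"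
    using assms(1)[rule_format, of "composition_monomial \<beta>"] fl[OF pos] less.prems
    unfolding Psi_expansion_eq by (simp add: sum_M_qsym)
  moreover have "(\<Sum>\<alpha> | \<alpha> \<in> compositions n \<and> comp_le \<alpha> \<beta>. c \<alpha> / of_nat (pi2_comp \<alpha> \<beta>)) =
    (\<Sum>\<alpha> | \<alpha> \<in> compositions n \<and> comp_le \<alpha> \<beta>. if \<alpha> = \<beta> then c \<beta> / of_nat (pi2_comp \<beta> \<beta>) else 0)"
  proof (rule sum.cong[OF refl])
    fix \<alpha> assume "\<alpha> \<in> {\<alpha>. \<alpha> \<in> compositions n \<and> comp_le \<alpha> \<beta>}"
    then have \<alpha>: "\<alpha> \<in> compositions n" "comp_le \<alpha> \<beta>" by auto
    have "c \<alpha> = 0" if "\<alpha> \<noteq> \<beta>"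
    proof (rule less.hyps[OF _ \<alpha>(1)])
      show "n - length \<alpha> < n - length \<beta>"
        using comp_le_length[OF \<alpha>(1) less.prems \<alpha>(2)] that length_composition[OF \<alpha>(1)] by linarith
    qed
    then show "c \<alpha> / of_nat (pi2_comp \<alpha> \<beta>) = (if \<alpha> = \<beta> then c \<beta> / of_nat (pi2_comp \<beta> \<beta>) else 0)"
      by auto
  qed
  ultimately show ?case
    using less.prems pi2_comp_self_pos[OF pos] by (simp add: finite_compositions comp_le_refl)
qed

lemma Psi_independent:
  fixes c :: "nat list \<Rightarrow> rat poly"
  assumes "\<forall>m. (\<Sum>\<alpha>\<in>compositions n. c \<alpha> * [:Psi_qsym \<alpha> m / of_nat (z_comp \<alpha>):]) =
     (\<Sum>\<alpha>\<in>compositions n. c' \<alpha> * [:Psi_qsym \<alpha> m / of_nat (z_comp \<alpha>):])"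
    and "\<beta> \<in> compositions n"
  shows "c \<beta> = c' \<beta>"
proof (rule poly_eqI)
  fix k
  have "coeff (c \<beta>) k - coeff (c' \<beta>) k = 0"
  proof (rule Psi_independent_rat[OF _ assms(2)], rule allI)
    fix m
    have "coeff (\<Sum>\<alpha>\<in>compositions n. c \<alpha> * [:Psi_qsym \<alpha> m / of_nat (z_comp \<alpha>):]) k =
       coeff (\<Sum>\<alpha>\<in>compositions n. c' \<alpha> * [:Psi_qsym \<alpha> m / of_nat (z_comp \<alpha>):]) k"
      using assms(1) by simp
    then show "(\<Sum>\<alpha>\<in>compositions n. (coeff (c \<alpha>) k - coeff (c' \<alpha>) k) *
       (Psi_qsym \<alpha> m / of_nat (z_comp \<alpha>))) = 0"
      by (simp add: coeff_sum algebra_simps diff_divide_distrib sum_subtractf)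
  qed
  then show "coeff (c \<beta>) k = coeff (c' \<beta>) k" by simp
qed

section \<open>Independence of the fundamental functions and uniqueness of the image under
  \<omega>\<close>

definition step_word :: "nat \<Rightarrow> nat set \<Rightarrow> nat list" where
  "step_word n T = map (\<lambda>i. Suc (card {t \<in> T. t \<le> i})) [0..<n]"

text \<open>The word increases exactly at the gaps in \<open>T\<close>. A sorted word is determined
  by its content, so it is the only candidate, and it is admissible for \<open>S\<close> exactly
  when \<open>S \<subseteq> T\<close>.\<close>

lemma F_qsym_step_word:
  assumes "S \<subseteq> {1..<n}" "T \<subseteq> {1..<n}"
  shows "F_qsym n S (count_list (step_word n T)) = (if S \<subseteq> T then 1 else 0)"
proof -
  let ?js = "step_word n T"
  have finT: "finite T" using assms(2) finite_subset by blast
  have l: "length ?js = n" by (simp add: step_word_def)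
  have so: "sorted ?js"
    unfolding step_word_def sorted_iff_nth_mono using finT by (auto intro!: card_mono)
  have asc: "?js ! (i - 1) < ?js ! i \<longleftrightarrow> i \<in> T" if "i \<in> {1..<n}" for i
  proof -
    have fin: "finite {t \<in> T. t \<le> i - 1}" using finT by simp
    have "card {t \<in> T. t \<le> i - 1} < card {t \<in> T. t \<le> i} \<longleftrightarrow> i \<in> T"
    proof (cases "i \<in> T")
      case True
      then have "{t \<in> T. t \<le> i} = insert i {t \<in> T. t \<le> i - 1}" using that by auto
      moreover have "i \<notin> {t \<in> T. t \<le> i - 1}" using that by auto
      ultimately show ?thesis using True card_insert_disjoint[OF fin] by simp
    next
      case False
      then have "t \<le> i \<longleftrightarrow> t \<le> i - 1" if "t \<in> T" for t
        using that by (cases "t = i") auto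
      then have "{t \<in> T. t \<le> i} = {t \<in> T. t \<le> i - 1}" by blast
      then show ?thesis using False by simp
    qed
    moreover have "i - 1 < n" "i < n" using that by auto
    ultimately show ?thesis by (simp add: step_word_def)
  qed
  have uniq: "js = ?js" if "sorted js" "\<forall>c. count_list js c = count_list ?js c" for js
    using that so by (metis count_mset multiset_eqI properties_for_sort sorted_sort_id)
  have "{js :: nat list. length js = n \<and> sorted js \<and> (\<forall>x\<in>set js. 1 \<le> x) \<and>
     (\<forall>i\<in>S. js ! (i - 1) < js ! i) \<and> (\<forall>c. count_list js c = count_list ?js c)} = (if S \<subseteq> T then {?js} else {})"
    (is "?X = _")
  proof (cases "S \<subseteq> T")
    case True
    have "\<forall>i\<in>S. ?js ! (i - 1) < ?js ! i" using asc assms(1) True by blast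
    moreover have "\<forall>x\<in>set ?js. 1 \<le> x" by (simp add: step_word_def)
    ultimately have "?js \<in> ?X" using so l by blast
    then show ?thesis using uniq True by auto
  next
    case False
    then obtain i where i: "i \<in> S" "i \<notin> T" by blast
    then have nasc: "\<not> ?js ! (i - 1) < ?js ! i" using asc assms(1) by blast
    have "js \<notin> ?X" for js
    proof
      assume js: "js \<in> ?X"
      then have "js = ?js" using uniq by simp
      moreover have "js ! (i - 1) < js ! i" using js i(1) by simp
      ultimately show False using nasc by simp
    qed
    then have "?X = {}" by blast
    then show ?thesis using False by simp
  qed
  then show ?thesis unfolding F_qsym_def by simp
qed

text \<open>Evaluation at the step word of \<open>T\<close> gives the sum of the coefficients over
  all subsets of \<open>T\<close>; these subset sums determine the coefficients by induction on
  size.\<close>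

lemma F_independent:
  fixes d d' :: "nat set \<Rightarrow> rat poly"
  assumes "\<forall>m. (\<Sum>S\<in>Pow {1..<n}. d S * [:F_qsym n S m:]) = (\<Sum>S\<in>Pow {1..<n}. d' S * [:F_qsym n S m:])"
    and "T \<subseteq> {1..<n}"
  shows "d T = d' T"
  using assms(2)
proof (induction "card T" arbitrary: T rule: less_induct)
  case less
  have finT: "finite T" using less.prems finite_subset by blast
  have ev: "(\<Sum>S\<in>Pow {1..<n}. e S * [:F_qsym n S (count_list (step_word n T)):]) = e T + (\<Sum>S\<in>Pow T - {T}. e S)"
    for e :: "nat set \<Rightarrow> rat poly"
  proof -
    have "(\<Sum>S\<in>Pow {1..<n}. e S * [:F_qsym n S (count_list (step_word n T)):]) = (\<Sum>S\<in>Pow T. e S)"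
      by (rule sum.mono_neutral_cong_right)
         (use less.prems in \<open>auto simp: F_qsym_step_word one_pCons[symmetric]\<close>)
    also have "\<dots> = e T + (\<Sum>S\<in>Pow T - {T}. e S)" using finT by (intro sum.remove) auto
    finally show ?thesis .
  qed
  have "(\<Sum>S\<in>Pow T - {T}. d S) = (\<Sum>S\<in>Pow T - {T}. d' S)"
    using finT less.prems by (intro sum.cong refl less.hyps) (auto intro: psubset_card_mono)
  then show ?case
    using assms(1)[rule_format, of "count_list (step_word n T)"] unfolding ev by simp
qed

text \<open>\<open>omega_rel\<close> allows any family of coefficients; their uniqueness turns the
  relation into a partial function.\<close>

lemma omega_rel_unique:
  assumes "omega_rel n f g" "omega_rel n f g'"
  shows "g m = g' m"
proof -
  obtain d where d: "\<forall>m. f m = (\<Sum>S\<in>Pow {1..<n}. d S * [:F_qsym n S m:])"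
      "g m = (\<Sum>S\<in>Pow {1..<n}. d S * [:F_qsym n (omega_set n S) m:])"
    using assms(1) unfolding omega_rel_def by blast
  obtain d' where d': "\<forall>m. f m = (\<Sum>S\<in>Pow {1..<n}. d' S * [:F_qsym n S m:])"
      "g' m = (\<Sum>S\<in>Pow {1..<n}. d' S * [:F_qsym n (omega_set n S) m:])"
    using assms(2) unfolding omega_rel_def by blast
  have "d S = d' S" if "S \<subseteq> {1..<n}" for S
    using F_independent[where n = n and d = d and d' = d' and T = S] that d(1) d'(1) by simp
  then show ?thesis unfolding d(2) d'(2) by (intro sum.cong) auto
qed

section \<open>The coefficients\<close>

definition nat_poly :: "rat poly \<Rightarrow> bool" where
  "nat_poly p \<longleftrightarrow> (\<forall>k. coeff p k \<in> \<nat>)"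

lemma Nats_sum: "(\<And>x. x \<in> A \<Longrightarrow> f x \<in> \<nat>) \<Longrightarrow> sum f A \<in> \<nat>"
  by (induction A rule: infinite_finite_induct) auto

lemma nat_poly_sum: "(\<And>x. x \<in> A \<Longrightarrow> nat_poly (f x)) \<Longrightarrow> nat_poly (sum f A)"
  unfolding nat_poly_def coeff_sum by (blast intro: Nats_sum)

lemma nat_poly_add: "nat_poly p \<Longrightarrow> nat_poly q \<Longrightarrow> nat_poly (p + q)"
  by (simp add: nat_poly_def)

lemma nat_poly_mult: "nat_poly p \<Longrightarrow> nat_poly q \<Longrightarrow> nat_poly (p * q)"
  unfolding nat_poly_def coeff_mult by (intro allI Nats_sum Nats_mult) auto

lemma nat_poly_prod: "(\<And>x. x \<in> A \<Longrightarrow> nat_poly (f x)) \<Longrightarrow> nat_poly (prod f A)"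
proof (induction A rule: infinite_finite_induct)
  case (insert x F)
  then show ?case by (simp add: nat_poly_mult)
qed (auto simp: nat_poly_def coeff_1)

text \<open>The subtraction hides the positivity; the recursion for \<open>e + 1\<close> exhibits it
  with sums and products only.\<close>

lemma nat_poly_shift_power: "nat_poly ([:1, 1:] ^ e - 1)"
proof (induction e)
  case (Suc e)
  have "([:1, 1:] ^ Suc e - 1 :: rat poly) = [:1, 1:] * ([:1, 1:] ^ e - 1) + [:0, 1:]"
    by (simp add: algebra_simps one_pCons)
  moreover have "nat_poly [:1, 1:]" "nat_poly [:0, 1:]"
    by (auto simp: nat_poly_def coeff_pCons split: nat.split)
  ultimately show ?case using Suc by (simp only: nat_poly_add nat_poly_mult)
qed (simp add: nat_poly_def)

text \<open>\<open>A\<close> is a set of pairs rather than of single edges. The factor of a pair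
  adds up q^k over the nonempty sets of k parallel edges, so a pair without edges makes the weight
  0.\<close>

definition edge_weight :: "(nat \<Rightarrow> nat \<Rightarrow> nat) \<Rightarrow> (nat \<times> nat) set \<Rightarrow> rat poly" where
  "edge_weight E A = (\<Prod>(i, j)\<in>A. [:1, 1:] ^ E i j - 1)"

lemma nat_poly_edge_weight: "nat_poly (edge_weight E A)"
  unfolding edge_weight_def by (intro nat_poly_prod) (auto intro: nat_poly_shift_power)

text \<open>Each ascending pair contributes the factor (q+1)^e = 1 + ((q+1)^e - 1), every other pair
  1 + 0. Expanding the product chooses the set \<open>A\<close>.\<close>

lemma shifted_monom_expansion:
  "pcompose (monom 1 (asc n E \<kappa>)) [:1, 1:] =
   (\<Sum>A\<in>Pow ({1..n} \<times> {1..n}). if \<forall>(i, j)\<in>A. \<kappa> i < \<kappa> j then edge_weight E A else 0)"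
proof -
  let ?V = "{1..n} \<times> {1..n}"
  let ?w = "\<lambda>(i, j). if \<kappa> i < \<kappa> j then [:1, 1:] ^ E i j - 1 else (0 :: rat poly)"
  have asc: "asc n E \<kappa> = (\<Sum>(i, j)\<in>?V. if \<kappa> i < \<kappa> j then E i j else 0)"
    unfolding asc_def by (rule sum.cartesian_product)
  have "pcompose (monom 1 k) [:1, 1:] = ([:1, 1:] :: rat poly) ^ k" for k
    by (induction k) (simp_all add: monom_0 monom_Suc pcompose_pCons)
  then have "pcompose (monom 1 (asc n E \<kappa>)) [:1, 1:] = ([:1, 1:] :: rat poly) ^ asc n E \<kappa>" .
  also have "\<dots> = (\<Prod>x\<in>?V. ?w x + 1)"
    unfolding asc power_sum by (intro prod.cong) auto
  also have "\<dots> = (\<Sum>A\<in>Pow ?V. prod ?w A)"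
    by (subst prod_add) auto
  also have "\<dots> = (\<Sum>A\<in>Pow ?V. if \<forall>(i, j)\<in>A. \<kappa> i < \<kappa> j then edge_weight E A else 0)"
  proof (rule sum.cong[OF refl])
    fix A assume "A \<in> Pow ?V"
    then have fin: "finite A" by (meson PowD finite_SigmaI finite_atLeastAtMost finite_subset)
    show "prod ?w A = (if \<forall>(i, j)\<in>A. \<kappa> i < \<kappa> j then edge_weight E A else 0)"
    proof (cases "\<forall>(i, j)\<in>A. \<kappa> i < \<kappa> j")
      case True
      then have "prod ?w A = edge_weight E A"
        unfolding edge_weight_def by (intro prod.cong) auto
      then show ?thesis using True by simp
    next
      case False
      then obtain x where "x \<in> A" "?w x = 0" by auto
      then have "\<exists>x\<in>A. ?w x = 0" by blast
      with fin have "prod ?w A = 0" by (rule prod_zero)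
      then show ?thesis unfolding if_not_P[OF False] .
    qed
  qed
  finally show ?thesis .
qed

lemma LLT_shift_expansion:
  "LLT_shift n E m = (\<Sum>A\<in>Pow ({1..n} \<times> {1..n}). edge_weight E A *
     [:of_nat (card {\<kappa> \<in> colorings_with_content n m. \<forall>(i, j)\<in>A. \<kappa> i < \<kappa> j}):])"
proof -
  let ?C = "colorings_with_content n m"
  have "LLT_shift n E m = (\<Sum>\<kappa>\<in>?C. \<Sum>A\<in>Pow ({1..n} \<times> {1..n}).
      if \<forall>(i, j)\<in>A. \<kappa> i < \<kappa> j then edge_weight E A else 0)"
    unfolding LLT_shift_def LLT_def pcompose_sum shifted_monom_expansion ..
  also have "\<dots> = (\<Sum>A\<in>Pow ({1..n} \<times> {1..n}). \<Sum>\<kappa>\<in>?C.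
      if \<forall>(i, j)\<in>A. \<kappa> i < \<kappa> j then edge_weight E A else 0)"
    by (rule sum.swap)
  also have "\<dots> = (\<Sum>A\<in>Pow ({1..n} \<times> {1..n}). edge_weight E A *
     [:of_nat (card {\<kappa> \<in> ?C. \<forall>(i, j)\<in>A. \<kappa> i < \<kappa> j}):])"
    by (simp only: sum.inter_filter[OF finite_colorings, symmetric] sum_constant of_nat_poly mult.commute)
  finally show ?thesis .
qed

section \<open>Acyclic edge sets and their reachability orders\<close>

definition acyclic_labelling :: "nat \<Rightarrow> (nat \<times> nat) set \<Rightarrow> (nat \<Rightarrow> int) \<Rightarrow> bool" where
  "acyclic_labelling n A r \<longleftrightarrow> inj_on r {1..n} \<and> (\<forall>(i, j)\<in>A. r j < r i)"

text \<open>The color, negated and scaled by n + 1, dominates, so labels drop along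
  \<open>A\<close>; the residue modulo n + 1 recovers the vertex, so labels are distinct. Its use is
  the contrapositive: a set \<open>A\<close> without a labelling has no strict coloring.\<close>

lemma strict_coloring_labelling:
  assumes "A \<subseteq> {1..n} \<times> {1..n}" "\<forall>(i, j)\<in>A. \<kappa> i < (\<kappa> j :: nat)"
  shows "acyclic_labelling n A (\<lambda>i. int i - int (\<kappa> i) * (int n + 1))"
  unfolding acyclic_labelling_def
proof (intro conjI inj_onI ballI; clarify?)
  fix i j assume ij: "i \<in> {1..n}" "j \<in> {1..n}"
    "int i - int (\<kappa> i) * (int n + 1) = int j - int (\<kappa> j) * (int n + 1)"
  then have "(int i - int (\<kappa> i) * (int n + 1)) mod (int n + 1) = (int j - int (\<kappa> j) * (int n + 1)) mod (int n + 1)"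
    by simp
  then have "int i mod (int n + 1) = int j mod (int n + 1)"
    by (metis mod_mult_self4 mult.commute diff_conv_add_uminus mult_minus_left mod_mult_self1)
  then show "i = j" using ij(1,2) by simp
next
  fix i j assume ij: "(i, j) \<in> A"
  then have "int (\<kappa> i) + 1 \<le> int (\<kappa> j)" using assms(2) by fastforce
  then have "(int (\<kappa> i) + 1) * (int n + 1) \<le> int (\<kappa> j) * (int n + 1)"
    by (intro mult_right_mono) auto
  moreover have "int j \<le> int n" "1 \<le> int i" using ij assms(1) by auto
  ultimately show "int j - int (\<kappa> j) * (int n + 1) < int i - int (\<kappa> i) * (int n + 1)"
    by (simp add: algebra_simps)
qed

text \<open>\<open>r\<close> increases strictly along every edge of \<open>A\<inverse>\<close>, so
  no nontrivial path returns to its start.\<close>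

lemma reachability_antisym:
  assumes "\<forall>(i, j)\<in>A. r j < (r i :: int)"
  shows "antisym ((A\<inverse>)\<^sup>*)"
proof (rule antisymI)
  have le: "r x \<le> r y" if "(x, y) \<in> (A\<inverse>)\<^sup>*" for x y
    using that by (induction) (use assms in fastforce)+
  have lt: "x = y \<or> r x < r y" if "(x, y) \<in> (A\<inverse>)\<^sup>*" for x y
    using that
  proof (cases rule: rtranclE)
    case (step z)
    then show ?thesis using le[of x z] assms by fastforce
  qed simp
  fix x y assume "(x, y) \<in> (A\<inverse>)\<^sup>*" "(y, x) \<in> (A\<inverse>)\<^sup>*"
  then show "x = y" using lt[of x y] lt[of y x] by auto
qed

lemma weak_iff_monotone:
  assumes "A \<subseteq> {1..n} \<times> {1..n}"
  shows "(\<forall>(i, j)\<in>A. \<kappa> j \<le> (\<kappa> i :: nat)) \<longleftrightarrow>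
    (\<forall>x\<in>{1..n}. \<forall>y\<in>{1..n}. (x, y) \<in> (A\<inverse>)\<^sup>* \<longrightarrow> \<kappa> x \<le> \<kappa> y)" (is "?L \<longleftrightarrow> ?R")
proof
  assume L: ?L
  have "\<kappa> x \<le> \<kappa> y" if "(x, y) \<in> (A\<inverse>)\<^sup>*" for x y
    using that by (induction) (use L in fastforce)+
  then show ?R by blast
next
  assume R: ?R
  show ?L
  proof clarify
    fix i j assume "(i, j) \<in> A"
    then show "\<kappa> j \<le> \<kappa> i" using R assms by blast
  qed
qed

text \<open>The existence of a labelling says that \<open>A\<close> is acyclic.\<close>

definition Psi_coefficient :: "nat \<Rightarrow> (nat \<Rightarrow> nat \<Rightarrow> nat) \<Rightarrow> nat list \<Rightarrow> rat poly" where
  "Psi_coefficient n E \<alpha> = (\<Sum>A | A \<subseteq> {1..n} \<times> {1..n} \<and> (\<exists>r. acyclic_labelling n A r).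
     edge_weight E A * of_nat (chain_count ((A\<inverse>)\<^sup>*) (has_least ((A\<inverse>)\<^sup>*)) {1..n} \<alpha>))"

lemma nat_poly_Psi_coefficient: "nat_poly (Psi_coefficient n E \<alpha>)"
  unfolding Psi_coefficient_def
  by (intro nat_poly_sum nat_poly_mult nat_poly_edge_weight)
    (auto simp: nat_poly_def of_nat_poly coeff_pCons split: nat.split)

text \<open>One family \<open>d\<close> has to serve both halves of \<open>omega_rel\<close>. It
  collects, by descent set, the weighted linear extensions of all acyclic \<open>A\<close>.\<close>

lemma Psi_coefficient_expansion: "is_Psi_expansion n E (Psi_coefficient n E)"
proof -
  let ?AA = "{A. A \<subseteq> {1..n} \<times> {1..n} \<and> (\<exists>r. acyclic_labelling n A r)}"
  \<comment> \<open>Descent sets depend on the labelling, so one labelling per \<open>A\<close> is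
    fixed for the strict and the weak expansion alike.\<close>
  define r where "r A = (SOME r. acyclic_labelling n A r)" for A
  have r: "inj_on (r A) {1..n}" "\<forall>(i, j)\<in>A. r A j < r A i" "A \<subseteq> {1..n} \<times> {1..n}" if "A \<in> ?AA" for A
  proof -
    have "acyclic_labelling n A (r A)" using that someI_ex[of "acyclic_labelling n A"] unfolding r_def by blast
    then show "inj_on (r A) {1..n}" "\<forall>(i, j)\<in>A. r A j < r A i" by (auto simp: acyclic_labelling_def)
    show "A \<subseteq> {1..n} \<times> {1..n}" using that by simp
  qed
  define L where "L A = {\<sigma> \<in> perms n. increasing_on A \<sigma>}" for A
  have finL: "finite (L A)" for A unfolding L_def by (simp add: finite_perms)
  define d where "d S = (\<Sum>A\<in>?AA. edge_weight E A * of_nat (card {\<sigma> \<in> L A. Des n (r A) \<sigma> = S}))" for S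
  \<comment> \<open>The function \<open>h\<close> is left general in order to substitute both the
    fundamental functions and their images under \<omega>.\<close>
  have regroup: "(\<Sum>S\<in>Pow {1..<n}. d S * [:h S:]) =
      (\<Sum>A\<in>?AA. edge_weight E A * [:\<Sum>\<sigma>\<in>L A. h (Des n (r A) \<sigma>):])" for h :: "nat set \<Rightarrow> rat"
  proof -
    have "(\<Sum>S\<in>Pow {1..<n}. d S * [:h S:]) = (\<Sum>S\<in>Pow {1..<n}. \<Sum>A\<in>?AA.
       edge_weight E A * [:\<Sum>\<sigma> | \<sigma> \<in> L A \<and> Des n (r A) \<sigma> = S. h (Des n (r A) \<sigma>):])"
      unfolding d_def sum_distrib_right
      by (intro sum.cong refl) (simp add: of_nat_poly mult.commute)
    also have "\<dots> = (\<Sum>A\<in>?AA. \<Sum>S\<in>Pow {1..<n}.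
       edge_weight E A * [:\<Sum>\<sigma> | \<sigma> \<in> L A \<and> Des n (r A) \<sigma> = S. h (Des n (r A) \<sigma>):])"
      by (rule sum.swap)
    also have "\<dots> = (\<Sum>A\<in>?AA. edge_weight E A * [:\<Sum>\<sigma>\<in>L A. h (Des n (r A) \<sigma>):])"
    proof (rule sum.cong[OF refl])
      fix A
      have "(\<Sum>S\<in>Pow {1..<n}. \<Sum>\<sigma> | \<sigma> \<in> L A \<and> Des n (r A) \<sigma> = S. h (Des n (r A) \<sigma>)) =
         (\<Sum>\<sigma>\<in>L A. h (Des n (r A) \<sigma>))"
        by (rule sum.group) (auto simp: finL Des_def)
      moreover have "(\<Sum>x\<in>X. [:f x:]) = [:sum f X:]" for f :: "nat set \<Rightarrow> rat" and X
        by (induction X rule: infinite_finite_induct) auto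
      ultimately show "(\<Sum>S\<in>Pow {1..<n}.
         edge_weight E A * [:\<Sum>\<sigma> | \<sigma> \<in> L A \<and> Des n (r A) \<sigma> = S. h (Des n (r A) \<sigma>):]) =
         edge_weight E A * [:\<Sum>\<sigma>\<in>L A. h (Des n (r A) \<sigma>):]"
        unfolding sum_distrib_left[symmetric] by simp
    qed
    finally show ?thesis .
  qed
  have f: "LLT_shift n E m = (\<Sum>S\<in>Pow {1..<n}. d S * [:F_qsym n S m:])" for m
  proof -
    have "LLT_shift n E m = (\<Sum>A\<in>?AA. edge_weight E A *
       [:of_nat (card {\<kappa> \<in> colorings_with_content n m. \<forall>(i, j)\<in>A. \<kappa> i < \<kappa> j}):])"
      unfolding LLT_shift_expansion
    proof (rule sum.mono_neutral_right)
      show "\<forall>A\<in>Pow ({1..n} \<times> {1..n}) - ?AA. edge_weight E A *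
         [:of_nat (card {\<kappa> \<in> colorings_with_content n m. \<forall>(i, j)\<in>A. \<kappa> i < \<kappa> j}):] = 0"
      proof
        fix A assume A: "A \<in> Pow ({1..n} \<times> {1..n}) - ?AA"
        then have "\<not> (\<forall>(i, j)\<in>A. \<kappa> i < \<kappa> j)" for \<kappa> :: "nat \<Rightarrow> nat"
          using strict_coloring_labelling[of A n \<kappa>] by blast
        then have "{\<kappa> \<in> colorings_with_content n m. \<forall>(i, j)\<in>A. \<kappa> i < \<kappa> j} = {}" by blast
        then show "edge_weight E A *
         [:of_nat (card {\<kappa> \<in> colorings_with_content n m. \<forall>(i, j)\<in>A. \<kappa> i < \<kappa> j}):] = 0"
          by (simp only: card.empty) simp
      qed
    qed auto
    also have "\<dots> = (\<Sum>A\<in>?AA. edge_weight E A * [:\<Sum>\<sigma>\<in>L A. F_qsym n (Des n (r A) \<sigma>) m:])"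
    proof (rule sum.cong[OF refl])
      fix A assume "A \<in> ?AA"
      from strict_weak_expansion(1)[OF r(1)[OF this] r(3)[OF this] r(2)[OF this], of m]
      show "edge_weight E A *
         [:of_nat (card {\<kappa> \<in> colorings_with_content n m. \<forall>(i, j)\<in>A. \<kappa> i < \<kappa> j}):] =
         edge_weight E A * [:\<Sum>\<sigma>\<in>L A. F_qsym n (Des n (r A) \<sigma>) m:]"
        unfolding L_def by (simp only:)
    qed
    also have "\<dots> = (\<Sum>S\<in>Pow {1..<n}. d S * [:F_qsym n S m:])"
      by (rule regroup[symmetric])
    finally show ?thesis .
  qed
  have g: "(\<Sum>\<alpha>\<in>compositions n. Psi_coefficient n E \<alpha> * [:Psi_qsym \<alpha> m / of_nat (z_comp \<alpha>):]) =
      (\<Sum>S\<in>Pow {1..<n}. d S * [:F_qsym n (omega_set n S) m:])" for m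
  proof -
    let ?P = "\<lambda>A :: (nat \<times> nat) set. (A\<inverse>)\<^sup>*"
    let ?c = "\<lambda>A \<alpha>. chain_count (?P A) (has_least (?P A)) {1..n} \<alpha>"
    have const: "(\<Sum>x\<in>X. [:f x:]) = [:sum f X:]" for f :: "nat list \<Rightarrow> rat" and X
      by (induction X rule: infinite_finite_induct) auto
    have "(\<Sum>\<alpha>\<in>compositions n. Psi_coefficient n E \<alpha> * [:Psi_qsym \<alpha> m / of_nat (z_comp \<alpha>):]) =
       (\<Sum>\<alpha>\<in>compositions n. \<Sum>A\<in>?AA. edge_weight E A * [:of_nat (?c A \<alpha>) * (Psi_qsym \<alpha> m / of_nat (z_comp \<alpha>)):])"
      unfolding Psi_coefficient_def sum_distrib_right
      by (intro sum.cong refl) (simp add: of_nat_poly mult.commute)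
    also have "\<dots> = (\<Sum>A\<in>?AA. edge_weight E A *
        [:\<Sum>\<alpha>\<in>compositions n. of_nat (?c A \<alpha>) * (Psi_qsym \<alpha> m / of_nat (z_comp \<alpha>)):])"
      by (subst sum.swap) (simp only: sum_distrib_left[symmetric] const)
    also have "\<dots> = (\<Sum>A\<in>?AA. edge_weight E A * [:\<Sum>\<sigma>\<in>L A. F_qsym n (omega_set n (Des n (r A) \<sigma>)) m:])"
    proof (rule sum.cong[OF refl])
      fix A assume A: "A \<in> ?AA"
      have "(\<Sum>\<alpha>\<in>compositions n. of_nat (?c A \<alpha>) * (Psi_qsym \<alpha> m / of_nat (z_comp \<alpha>))) =
         of_nat (card {\<kappa> \<in> colorings_with_content n m. \<forall>(i, j)\<in>A. \<kappa> j \<le> \<kappa> i})"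
        unfolding weak_iff_monotone[OF r(3)[OF A]]
        by (rule monotone_colorings_Psi[symmetric])
          (auto intro: refl_rtrancl trans_rtrancl reachability_antisym[OF r(2)[OF A]])
      also have "\<dots> = (\<Sum>\<sigma>\<in>L A. F_qsym n (omega_set n (Des n (r A) \<sigma>)) m)"
        unfolding L_def by (rule strict_weak_expansion(2)[OF r(1)[OF A] r(3)[OF A] r(2)[OF A]])
      finally show "edge_weight E A *
        [:\<Sum>\<alpha>\<in>compositions n. of_nat (?c A \<alpha>) * (Psi_qsym \<alpha> m / of_nat (z_comp \<alpha>)):] =
        edge_weight E A * [:\<Sum>\<sigma>\<in>L A. F_qsym n (omega_set n (Des n (r A) \<sigma>)) m:]"
        by (simp only:)
    qed
    also have "\<dots> = (\<Sum>S\<in>Pow {1..<n}. d S * [:F_qsym n (omega_set n S) m:])"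
      by (rule regroup[symmetric])
    finally show ?thesis .
  qed
  show ?thesis
    unfolding is_Psi_expansion_def omega_rel_def using f g by (intro exI[of _ d]) simp
qed

theorem theorem7p7:
  fixes n :: nat and E :: "nat \<Rightarrow> nat \<Rightarrow> nat"
  assumes "is_digraph n E"
  shows "(\<exists>c. is_Psi_expansion n E c) \<and>
         (\<forall>c. is_Psi_expansion n E c \<longrightarrow>
              (\<forall>\<alpha>\<in>compositions n. \<forall>k. coeff (c \<alpha>) k \<in> \<nat>))"
proof (intro conjI allI impI ballI)
  show "\<exists>c. is_Psi_expansion n E c" using Psi_coefficient_expansion by blast
next
  fix c \<alpha> k assume c: "is_Psi_expansion n E c" and \<alpha>: "\<alpha> \<in> compositions n"
  \<comment> \<open>Both expansions are images of the same function under \<omega>, hence equal, and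
    independence of the \<Psi> functions identifies the coefficients.\<close>
  have "c \<alpha> = Psi_coefficient n E \<alpha>"
    using omega_rel_unique[OF c[unfolded is_Psi_expansion_def]
        Psi_coefficient_expansion[unfolded is_Psi_expansion_def]]
    by (intro Psi_independent[OF _ \<alpha>]) blast
  then show "coeff (c \<alpha>) k \<in> \<nat>" using nat_poly_Psi_coefficient by (simp add: nat_poly_def)
qed

end
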